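(* Let $\bar I : \mathbb{R}^{3N_1}\times \mathcal{D} \to [0,\infty]$, with $\mathcal{D}\subset \mathrm{SO}(3)^{N_2}$, be the algebraic Cosserat shell energy without external loads, obtained from the finite-strain Cosserat shell energy $I$ by discretizing the midsurface deformation with $p_1$-th order Lagrange finite elements and the microrotation field with $p_2$-th order geodesic finite elements (all defined in the context). Then $\bar I$ is frame-invariant: for all $Q\in \mathrm{SO}(3)$ and all $(\bar m,\overline{\overline{R}})\in \mathbb{R}^{3N_1}\times\mathcal{D}$, one has $Q\overline{\overline{R}}\in\mathcal{D}$ and $$\bar I(Q\bar m,\,Q\overline{\overline{R}}) = \bar I(\bar m,\overline{\overline{R}}),$$ where $Q$ acts componentwise: $(Q\bar m)_i = Q\bar m_i$ for $\bar m=(\bar m_1,\dots,\bar m_{N_1})\in(\mathbb{R}^3)^{N_1}$, and $(Q\overline{\overline{R}})_i = Q\,\overline{\overline{R}}_i$ (matrix product) for $\overline{\overline{R}}\in \mathrm{SO}(3)^{N_2}$.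
   Context: **Continuous energy.** Let $\omega\subset\mathbb{R}^2$ be a bounded Lipschitz domain with piecewise linear boundary. Fix parameters $h>0$ (thickness), $\mu,\lambda>0$ (Lamé constants), $\mu_c\ge 0$ (Cosserat couple modulus), $0<\kappa\le 1$ (shear correction factor), $L_c>0$ (internal length), $q\ge 2$. For $m\in H^1(\omega,\mathbb{R}^3)$ and $\overline R\in W^{1,q}(\omega,\mathrm{SO}(3))$ with columns $\overline R=(\overline R_1|\overline R_2|\overline R_3)$ define $$I(m,\overline R)=\int_\omega h\,W_{\mathrm{mp}}+h\,W_{\mathrm{curv}}+\frac{h^3}{12}\,W_{\mathrm{bend}}\;d\omega .$$ Here $\nabla m=(m_x|m_y)$ is the $3\times2$ Jacobian matrix, $\|\cdot\|$ is the Frobenius norm, $\operatorname{sym}$ and $\operatorname{skew}$ are the symmetric and skew-symmetric parts of a square matrix, $1_2$ is the $2\times 2$ identity matrix, and $$\begin{aligned}W_{\mathrm{mp}}={}&\mu\|\operatorname{sym}((\overline R_1|\overline R_2)^T\nabla m-1_2)\|^2+\mu_c\|\operatorname{skew}((\overline R_1|\overline R_2)^T\nabla m)\|^2\\&+\frac{\mu+\mu_c}{2}\,\kappa\big(\langle\overline R_3,m_x\rangle^2+\langle\overline R_3,m_y\rangle^2\big)\\&+\frac{\mu\lambda}{2\mu+\lambda}\cdot\frac12\Big((\det(\nabla m|\overline R_3)-1)^2+(\det(\nabla m|\overline R_3)^{-1}-1)^2\Big)\end{aligned}$$ (taken to be $+\infty$ where $\det(\nabla m|\overline R_3)=0$).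 With $\mathfrak K_s^i=\overline R^T(\nabla\overline R_i|0)\in\mathbb{R}^{3\times3}$ for $i=1,2,3$ and $\mathfrak K_b=\mathfrak K_s^3$, $$W_{\mathrm{curv}}=\mu L_c^q\big(\|\mathfrak K_s^1\|^2+\|\mathfrak K_s^2\|^2+\|\mathfrak K_s^3\|^2\big)^{q/2},$$ $$W_{\mathrm{bend}}=\mu\|\operatorname{sym}\mathfrak K_b\|^2+\mu_c\|\operatorname{skew}\mathfrak K_b\|^2+\frac{\mu\lambda}{2\mu+\lambda}\big(\operatorname{tr}[\operatorname{sym}\mathfrak K_b]\big)^2 .$$ The integrand is nonnegative, so $I$ takes values in $[0,\infty]$. **Finite element spaces.** Let $\mathcal G$ be a conforming grid of $\omega$ with triangle and/or quadrilateral elements $T$. For each $T$ let $\mathcal F_T:T\to T_{\mathrm{ref}}$ be the affine or multilinear map to the reference element $T_{\mathrm{ref}}$ (reference triangle or quadrilateral). For $p\ge1$ let $\lambda_1,\dots,\lambda_k$ be the $p$-th order Lagrangian shape functions on $T_{\mathrm{ref}}$ with Lagrange nodes $a_1,\dots,a_k$, so that $\lambda_i(a_j)=\delta_{ij}$ and $\sum_i\lambda_i\equiv1$. - $V^{\mathbb{R}^3}_{p_1,h}\subset H^1(\omega,\mathbb{R}^3)$ is the space of standard $p_1$-th order conforming Lagrange finite element functions with values in $\mathbb{R}^3$. It has $N_1$ global Lagrange nodes. - Let $\operatorname{dist}(R_1,R_2)=\|\log R_1^TR_2\|$ be the canonical geodesic distance on $\mathrm{SO}(3)$. Geodesic interpolation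 of values $R_1,\dots,R_k\in\mathrm{SO}(3)$ at the Lagrange nodes is $$\Upsilon(R_1,\dots,R_k;\xi)=\operatorname*{arg\,min}_{R\in\mathrm{SO}(3)}\sum_{i=1}^k\lambda_i(\xi)\operatorname{dist}(R_i,R)^2,\qquad \xi\in T_{\mathrm{ref}}.$$ A $p_2$-th order geodesic finite element (GFE) function is a continuous $R_h:\omega\to\mathrm{SO}(3)$ such that for each element $T$, the restriction is $R_h|_T(x)=\Upsilon(R_{T,1},\dots,R_{T,k};\mathcal F_T(x))$, where the $R_{T,i}\in\mathrm{SO}(3)$ are the values at the Lagrange nodes of $T$ (if the minimizer is not unique, the equality means that $R_h|_T(x)$ is one of the minimizers). The set of these functions is $V^{\mathrm{SO}(3)}_{p_2,h}\subset W^{1,q}(\omega,\mathrm{SO}(3))$. There are $N_2$ global Lagrange nodes $n_1,\dots,n_{N_2}$ of order $p_2$. **Algebraic energy.** Let $\mathcal E_{p_1}:V^{\mathbb{R}^3}_{p_1,h}\to\mathbb{R}^{3N_1}$ and $\mathcal E_{p_2}:V^{\mathrm{SO}(3)}_{p_2,h}\to\mathrm{SO}(3)^{N_2}$ be pointwise evaluation at the respective Lagrange nodes, e.g. $\mathcal E_{p_2}(\overline R_h)_i=\overline R_h(n_i)$. The map $\mathcal E_{p_1}$ is a bijection. Let $\mathcal D\subset\mathrm{SO}(3)^{N_2}$ be the set of coefficient vectors $\overline{\overline R}$ for which there is exactly one GFE function in $V^{\mathrm{SO}(3)}_{p_2,h}$ with $\mathcal E_{p_2}(\overline R_h)=\overline{\overline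 R}$; write $\mathcal E_{p_2}^{-1}(\overline{\overline R})$ for this function. The algebraic Cosserat shell energy is $$\bar I(\bar m,\overline{\overline R})=I\big(\mathcal E_{p_1}^{-1}(\bar m),\mathcal E_{p_2}^{-1}(\overline{\overline R})\big),\qquad(\bar m,\overline{\overline R})\in\mathbb{R}^{3N_1}\times\mathcal D .$$ *)

theory Defs
  imports "HOL-Analysis.Analysis"
begin

section \<open>Domains\<close>

text \<open>A bounded Lipschitz domain: in a neighbourhood of each boundary point, and in suitable
  orthogonal coordinates, the domain is the strict epigraph of a Lipschitz function.\<close>

definition bounded_lipschitz_domain :: "(real^2) set \<Rightarrow> bool" where
  "bounded_lipschitz_domain \<omega> \<longleftrightarrow>
     open \<omega> \<and> connected \<omega> \<and> \<omega> \<noteq> {} \<and> bounded \<omega> \<and>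
     (\<forall>x \<in> frontier \<omega>. \<exists>r>0. \<exists>A :: real^2^2. \<exists>\<gamma> :: real \<Rightarrow> real. \<exists>L.
        orthogonal_matrix A \<and> L-lipschitz_on UNIV \<gamma> \<and>
        \<omega> \<inter> ball x r = {y \<in> ball x r. (A *v y) $ 2 > \<gamma> ((A *v y) $ 1)})"

definition piecewise_linear_boundary :: "(real^2) set \<Rightarrow> bool" where
  "piecewise_linear_boundary \<omega> \<longleftrightarrow>
     (\<exists>S. finite S \<and> frontier \<omega> = (\<Union>(a, b) \<in> S. closed_segment a b))"


section \<open>Sobolev spaces\<close>

fun Ck :: "nat \<Rightarrow> (real^2 \<Rightarrow> real) \<Rightarrow> bool" where
  "Ck 0 f \<longleftrightarrow> continuous_on UNIV f"
| "Ck (Suc k) f \<longleftrightarrow>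
     (\<forall>x. f differentiable (at x)) \<and> (\<forall>v. Ck k (\<lambda>x. frechet_derivative f (at x) v))"

definition smooth :: "(real^2 \<Rightarrow> real) \<Rightarrow> bool" where
  "smooth f \<longleftrightarrow> (\<forall>k. Ck k f)"

definition test_function :: "(real^2) set \<Rightarrow> (real^2 \<Rightarrow> real) \<Rightarrow> bool" where
  "test_function \<omega> \<phi> \<longleftrightarrow>
     smooth \<phi> \<and> (\<exists>K. compact K \<and> K \<subseteq> \<omega> \<and> (\<forall>x. x \<notin> K \<longrightarrow> \<phi> x = 0))"

definition partial_deriv :: "2 \<Rightarrow> (real^2 \<Rightarrow> real) \<Rightarrow> real^2 \<Rightarrow> real" where
  "partial_deriv i \<phi> x = frechet_derivative \<phi> (at x) (axis i 1)"

definition locally_integrable :: "(real^2) set \<Rightarrow> (real^2 \<Rightarrow> 'b::euclidean_space) \<Rightarrow> bool" where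
  "locally_integrable \<omega> u \<longleftrightarrow>
     (\<forall>K. compact K \<and> K \<subseteq> \<omega> \<longrightarrow> integrable (lebesgue_on K) u)"

definition is_weak_partial ::
    "(real^2) set \<Rightarrow> 2 \<Rightarrow> (real^2 \<Rightarrow> 'b::euclidean_space) \<Rightarrow> (real^2 \<Rightarrow> 'b) \<Rightarrow> bool" where
  "is_weak_partial \<omega> i u g \<longleftrightarrow>
     locally_integrable \<omega> u \<and> locally_integrable \<omega> g \<and>
     (\<forall>\<phi>. test_function \<omega> \<phi> \<longrightarrow>
        (LINT x|lebesgue_on \<omega>. partial_deriv i \<phi> x *\<^sub>R u x) =
        - (LINT x|lebesgue_on \<omega>. \<phi> x *\<^sub>R g x))"

text \<open>A weak partial derivative is unique up to a null set; the following picks a representative.\<close>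

definition weak_partial ::
    "(real^2) set \<Rightarrow> 2 \<Rightarrow> (real^2 \<Rightarrow> 'b::euclidean_space) \<Rightarrow> (real^2 \<Rightarrow> 'b)" where
  "weak_partial \<omega> i u = (SOME g. is_weak_partial \<omega> i u g)"

definition Lebesgue_space ::
    "real \<Rightarrow> (real^2) set \<Rightarrow> (real^2 \<Rightarrow> 'b::euclidean_space) set" where
  "Lebesgue_space q \<omega> =
     {u \<in> borel_measurable (lebesgue_on \<omega>). integrable (lebesgue_on \<omega>) (\<lambda>x. norm (u x) powr q)}"

definition Sobolev_1 ::
    "real \<Rightarrow> (real^2) set \<Rightarrow> (real^2 \<Rightarrow> 'b::euclidean_space) set" where
  "Sobolev_1 q \<omega> =
     {u \<in> Lebesgue_space q \<omega>. \<forall>i. \<exists>g \<in> Lebesgue_space q \<omega>. is_weak_partial \<omega> i u g}"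


section \<open>Rotations\<close>

definition SO3 :: "(real^3^3) set" where
  "SO3 = {R. rotation_matrix R}"

definition Sobolev_1_SO3 :: "real \<Rightarrow> (real^2) set \<Rightarrow> (real^2 \<Rightarrow> real^3^3) set" where
  "Sobolev_1_SO3 q \<omega> = {R \<in> Sobolev_1 q \<omega>. AE x in lebesgue_on \<omega>. R x \<in> SO3}"

text \<open>The product of \<^typ>\<open>real^3^3\<close> given by the type class \<^class>\<open>times\<close> is componentwise, so
  the matrix power and exponential are written with the matrix product.\<close>

definition matrix_power :: "real^3^3 \<Rightarrow> nat \<Rightarrow> real^3^3" where
  "matrix_power X k = ((\<lambda>Y. X ** Y) ^^ k) (mat 1)"

definition matrix_exponential :: "real^3^3 \<Rightarrow> real^3^3" where
  "matrix_exponential X = (\<Sum>k. (1 / fact k) *\<^sub>R matrix_power X k)"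

text \<open>The logarithm on the rotation group is the smallest skew-symmetric preimage under the
  exponential. It is unique for rotation angles below $\pi$; at angle $\pi$ there are two such
  preimages, which differ by a sign, so that the norm is determined in all cases.\<close>

definition rotation_log :: "real^3^3 \<Rightarrow> real^3^3" where
  "rotation_log R = arg_min norm (\<lambda>X. transpose X = - X \<and> matrix_exponential X = R)"

definition geodesic_dist :: "real^3^3 \<Rightarrow> real^3^3 \<Rightarrow> real" where
  "geodesic_dist R1 R2 = norm (rotation_log (transpose R1 ** R2))"


section \<open>The continuous shell energy\<close>

text \<open>The norm of the type \<^typ>\<open>real^'n^'m\<close> is the Frobenius norm.\<close>

definition sym_part :: "real^'n^'n \<Rightarrow> real^'n^'n" where
  "sym_part A = (1/2) *\<^sub>R (A + transpose A)"

definition skew_part :: "real^'n^'n \<Rightarrow> real^'n^'n" where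
  "skew_part A = (1/2) *\<^sub>R (A - transpose A)"

text \<open>Since \<^const>\<open>vector\<close> lists the rows of a matrix, these are the matrices with the given
  columns.\<close>

definition cols2 :: "real^3 \<Rightarrow> real^3 \<Rightarrow> real^2^3" where
  "cols2 a b = transpose (vector [a, b])"

definition cols3 :: "real^3 \<Rightarrow> real^3 \<Rightarrow> real^3 \<Rightarrow> real^3^3" where
  "cols3 a b c = transpose (vector [a, b, c])"

text \<open>Membrane energy density as a function of the partial derivatives \<open>mx\<close>, \<open>my\<close> of the
  deformation and of the rotation \<open>R\<close>.\<close>

definition W_mp ::
    "real \<Rightarrow> real \<Rightarrow> real \<Rightarrow> real \<Rightarrow> real^3 \<Rightarrow> real^3 \<Rightarrow> real^3^3 \<Rightarrow> ennreal" where
  "W_mp \<mu> \<mu>c lam \<kappa> mx my R =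
     (let U = transpose (cols2 (column 1 R) (column 2 R)) ** cols2 mx my;
          R3 = column 3 R;
          d = det (cols3 mx my R3)
      in if d = 0 then \<infinity>
         else ennreal
           (\<mu> * (norm (sym_part (U - mat 1)))\<^sup>2 + \<mu>c * (norm (skew_part U))\<^sup>2
            + (\<mu> + \<mu>c) / 2 * \<kappa> * ((R3 \<bullet> mx)\<^sup>2 + (R3 \<bullet> my)\<^sup>2)
            + \<mu> * lam / (2 * \<mu> + lam) * (1/2) * ((d - 1)\<^sup>2 + (inverse d - 1)\<^sup>2)))"

definition W_curv ::
    "real \<Rightarrow> real \<Rightarrow> real \<Rightarrow> real^3^3 \<Rightarrow> real^3^3 \<Rightarrow> real^3^3 \<Rightarrow> real" where
  "W_curv \<mu> Lc q K1 K2 K3 =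
     \<mu> * Lc powr q * ((norm K1)\<^sup>2 + (norm K2)\<^sup>2 + (norm K3)\<^sup>2) powr (q / 2)"

definition W_bend :: "real \<Rightarrow> real \<Rightarrow> real \<Rightarrow> real^3^3 \<Rightarrow> real" where
  "W_bend \<mu> \<mu>c lam K =
     \<mu> * (norm (sym_part K))\<^sup>2 + \<mu>c * (norm (skew_part K))\<^sup>2
     + \<mu> * lam / (2 * \<mu> + lam) * (trace (sym_part K))\<^sup>2"

definition curvature_strain ::
    "(real^2) set \<Rightarrow> (real^2 \<Rightarrow> real^3^3) \<Rightarrow> 3 \<Rightarrow> real^2 \<Rightarrow> real^3^3" where
  "curvature_strain \<omega> R i x =
     transpose (R x) **
     cols3 (weak_partial \<omega> 1 (\<lambda>y. column i (R y)) x) (weak_partial \<omega> 2 (\<lambda>y. column i (R y)) x) 0"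

text \<open>The energy is defined on $H^1(\omega,\mathbb{R}^3) \times W^{1,q}(\omega,\mathrm{SO}(3))$;
  as usual it is extended by infinity to all other pairs.\<close>

definition shell_energy ::
    "real \<Rightarrow> real \<Rightarrow> real \<Rightarrow> real \<Rightarrow> real \<Rightarrow> real \<Rightarrow> real \<Rightarrow> (real^2) set
     \<Rightarrow> (real^2 \<Rightarrow> real^3) \<Rightarrow> (real^2 \<Rightarrow> real^3^3) \<Rightarrow> ennreal" where
  "shell_energy h \<mu> \<mu>c lam \<kappa> Lc q \<omega> m R =
     (if m \<in> Sobolev_1 2 \<omega> \<and> R \<in> Sobolev_1_SO3 q \<omega> then
        \<integral>\<^sup>+x. (let K = (\<lambda>i. curvature_strain \<omega> R i x) in
              ennreal h * W_mp \<mu> \<mu>c lam \<kappa> (weak_partial \<omega> 1 m x) (weak_partial \<omega> 2 m x) (R x)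
              + ennreal (h * W_curv \<mu> Lc q (K 1) (K 2) (K 3))
              + ennreal (h^3 / 12 * W_bend \<mu> \<mu>c lam (K 3))) \<partial>(lebesgue_on \<omega>)
      else \<infinity>)"


section \<open>Grids\<close>

text \<open>An element is given by its corners; those of a quadrilateral are listed in cyclic order.\<close>

datatype element =
    Triangle "real^2" "real^2" "real^2"
  | Quadrilateral "real^2" "real^2" "real^2" "real^2"

fun ref_element :: "element \<Rightarrow> (real^2) set" where
  "ref_element (Triangle a b c) = {\<xi>. 0 \<le> \<xi>$1 \<and> 0 \<le> \<xi>$2 \<and> \<xi>$1 + \<xi>$2 \<le> 1}"
| "ref_element (Quadrilateral a b c d) = {\<xi>. 0 \<le> \<xi>$1 \<and> \<xi>$1 \<le> 1 \<and> 0 \<le> \<xi>$2 \<and> \<xi>$2 \<le> 1}"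

fun from_ref :: "element \<Rightarrow> real^2 \<Rightarrow> real^2" where
  "from_ref (Triangle a b c) \<xi> = (1 - \<xi>$1 - \<xi>$2) *\<^sub>R a + \<xi>$1 *\<^sub>R b + \<xi>$2 *\<^sub>R c"
| "from_ref (Quadrilateral a b c d) \<xi> =
     ((1 - \<xi>$1) * (1 - \<xi>$2)) *\<^sub>R a + (\<xi>$1 * (1 - \<xi>$2)) *\<^sub>R b
     + (\<xi>$1 * \<xi>$2) *\<^sub>R c + ((1 - \<xi>$1) * \<xi>$2) *\<^sub>R d"

definition cell :: "element \<Rightarrow> (real^2) set" where
  "cell T = from_ref T ` ref_element T"

definition to_ref :: "element \<Rightarrow> real^2 \<Rightarrow> real^2" where
  "to_ref T = the_inv_into (ref_element T) (from_ref T)"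

definition cross2 :: "real^2 \<Rightarrow> real^2 \<Rightarrow> real" where
  "cross2 u v = u$1 * v$2 - u$2 * v$1"

text \<open>For a quadrilateral this says that the corners are in strictly convex position, which makes
  the bilinear map \<^const>\<open>from_ref\<close> injective on the reference square.\<close>

fun nondegenerate :: "element \<Rightarrow> bool" where
  "nondegenerate (Triangle a b c) \<longleftrightarrow> cross2 (b - a) (c - a) \<noteq> 0"
| "nondegenerate (Quadrilateral a b c d) \<longleftrightarrow>
     (\<exists>s \<in> {1, -1}. 0 < s * cross2 (b - a) (d - a) \<and> 0 < s * cross2 (c - b) (a - b) \<and>
                    0 < s * cross2 (d - c) (b - c) \<and> 0 < s * cross2 (a - d) (c - d))"

fun vertices :: "element \<Rightarrow> (real^2) set" where
  "vertices (Triangle a b c) = {a, b, c}"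
| "vertices (Quadrilateral a b c d) = {a, b, c, d}"

text \<open>Edges are represented by their sets of end points.\<close>

fun edges :: "element \<Rightarrow> (real^2) set set" where
  "edges (Triangle a b c) = {{a, b}, {b, c}, {c, a}}"
| "edges (Quadrilateral a b c d) = {{a, b}, {b, c}, {c, d}, {d, a}}"

definition conforming_grid :: "(real^2) set \<Rightarrow> element set \<Rightarrow> bool" where
  "conforming_grid \<omega> G \<longleftrightarrow>
     finite G \<and> (\<forall>T \<in> G. nondegenerate T) \<and> (\<Union>T \<in> G. cell T) = closure \<omega> \<and>
     (\<forall>T \<in> G. \<forall>T' \<in> G. T \<noteq> T' \<longrightarrow>
        cell T \<inter> cell T' = {} \<or>
        (\<exists>v \<in> vertices T \<inter> vertices T'. cell T \<inter> cell T' = {v}) \<or>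
        (\<exists>e \<in> edges T \<inter> edges T'. cell T \<inter> cell T' = convex hull e))"


section \<open>Lagrange nodes and shape functions\<close>

text \<open>The equispaced Lagrange nodes of order \<open>p\<close> are the points $(i/p, j/p)$ of the reference
  element. Nodes and shape functions are indexed by the pairs $(i,j)$.\<close>

fun ref_indices :: "nat \<Rightarrow> element \<Rightarrow> (nat \<times> nat) set" where
  "ref_indices p (Triangle a b c) = {(i, j). i + j \<le> p}"
| "ref_indices p (Quadrilateral a b c d) = {(i, j). i \<le> p \<and> j \<le> p}"

fun ref_node :: "nat \<Rightarrow> nat \<times> nat \<Rightarrow> real^2" where
  "ref_node p (i, j) = vector [real i / real p, real j / real p]"

text \<open>\<open>lower_factor p i t\<close> has degree \<open>i\<close>, vanishes for $t = 0, 1/p, \ldots, (i-1)/p$, and is 1 for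
  $t = i/p$; \<open>lagrange_1d p i\<close> is the Lagrange polynomial of degree \<open>p\<close> on the unit interval.\<close>

definition lower_factor :: "nat \<Rightarrow> nat \<Rightarrow> real \<Rightarrow> real" where
  "lower_factor p i t = (\<Prod>l<i. (real p * t - real l) / (real i - real l))"

definition lagrange_1d :: "nat \<Rightarrow> nat \<Rightarrow> real \<Rightarrow> real" where
  "lagrange_1d p i t = (\<Prod>l\<in>{..p} - {i}. (real p * t - real l) / (real i - real l))"

text \<open>The dual basis to the nodes in the polynomials of total degree at most \<open>p\<close> (triangle), and
  in the polynomials of degree at most \<open>p\<close> in each variable (quadrilateral).\<close>

fun shape_fn :: "nat \<Rightarrow> element \<Rightarrow> nat \<times> nat \<Rightarrow> real^2 \<Rightarrow> real" where
  "shape_fn p (Triangle a b c) (i, j) \<xi> =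
     lower_factor p i (\<xi>$1) * lower_factor p j (\<xi>$2)
     * lower_factor p (p - i - j) (1 - \<xi>$1 - \<xi>$2)"
| "shape_fn p (Quadrilateral a b c d) (i, j) \<xi> = lagrange_1d p i (\<xi>$1) * lagrange_1d p j (\<xi>$2)"

lemma lower_factor_self: "p > 0 \<Longrightarrow> lower_factor p i (real i / real p) = 1"
  unfolding lower_factor_def by (intro prod.neutral) auto

lemma lower_factor_less: "p > 0 \<Longrightarrow> k < i \<Longrightarrow> lower_factor p i (real k / real p) = 0"
  unfolding lower_factor_def by (rule prod_zero) (auto intro!: bexI[of _ k])

lemma lagrange_1d_node:
  assumes "p > 0" "i \<le> p" "k \<le> p"
  shows "lagrange_1d p i (real k / real p) = (if k = i then 1 else 0)"
proof (cases "k = i")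
  case True
  have "(real p * (real i / real p) - real l) / (real i - real l) = 1" if "l \<noteq> i" for l
    using that assms(1) by simp
  then have "lagrange_1d p i (real i / real p) = 1"
    unfolding lagrange_1d_def by (intro prod.neutral) blast
  then show ?thesis
    using True by simp
next
  case False
  have "\<exists>l\<in>{..p} - {i}. (real p * (real k / real p) - real l) / (real i - real l) = 0"
    using False assms by (intro bexI[of _ k]) auto
  then show ?thesis
    using False unfolding lagrange_1d_def by (simp add: prod_zero)
qed

lemma shape_fn_node:
  assumes "p > 0" "a \<in> ref_indices p T" "b \<in> ref_indices p T"
  shows "shape_fn p T a (ref_node p b) = (if a = b then 1 else 0)"
proof (cases T)
  case (Quadrilateral A B C D)
  then show ?thesis
    using assms by (cases a; cases b) (auto simp: lagrange_1d_node)
next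
  case (Triangle A B C)
  obtain i j k l where ab: "a = (i, j)" "b = (k, l)" by (cases a; cases b) auto
  have le: "i + j \<le> p" "k + l \<le> p" using assms Triangle ab by auto
  have eq: "1 - real k / real p - real l / real p = real (p - k - l) / real p"
    using le assms(1) by (simp add: field_simps of_nat_diff)
  consider "a = b" | "k < i" | "l < j" | "p - k - l < p - i - j"
    using le ab by fastforce
  then show ?thesis
  proof cases
    case 1
    have "lower_factor p (p - k - l) (1 - real k / real p - real l / real p) = 1"
      using assms(1) unfolding eq by (rule lower_factor_self)
    then show ?thesis
      using 1 ab Triangle assms(1) by (simp add: lower_factor_self)
  next
    case 4
    have "lower_factor p (p - i - j) (1 - real k / real p - real l / real p) = 0"
      using assms(1) 4 unfolding eq by (rule lower_factor_less)
    moreover have "a \<noteq> b" using 4 ab by auto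
    ultimately show ?thesis using ab Triangle by simp
  qed (use ab Triangle assms(1) in \<open>auto simp: lower_factor_less\<close>)
qed

definition element_node :: "nat \<Rightarrow> element \<Rightarrow> nat \<times> nat \<Rightarrow> real^2" where
  "element_node p T a = from_ref T (ref_node p a)"

definition lagrange_nodes :: "nat \<Rightarrow> element set \<Rightarrow> (real^2) set" where
  "lagrange_nodes p G = (\<Union>T \<in> G. element_node p T ` ref_indices p T)"


section \<open>Finite element spaces\<close>

text \<open>Finite element functions live on the closure of the domain, which contains the nodes on the
  boundary; being \<^const>\<open>extensional\<close>, they are determined by their values there.\<close>

definition lagrange_fe_space :: "nat \<Rightarrow> (real^2) set \<Rightarrow> element set \<Rightarrow> (real^2 \<Rightarrow> real^3) set" where
  "lagrange_fe_space p \<omega> G =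
     {m \<in> extensional (closure \<omega>). continuous_on (closure \<omega>) m \<and>
        (\<forall>T \<in> G. \<exists>c. \<forall>x \<in> cell T.
           m x = (\<Sum>a \<in> ref_indices p T. shape_fn p T a (to_ref T x) *\<^sub>R c a))}"

text \<open>\<open>geodesic_interpolant p T R \<xi> S\<close> states that \<open>S\<close> is a (possibly not the only) value at \<open>\<xi>\<close> of
  the geodesic interpolation of the nodal values \<open>R\<close>.\<close>

definition geodesic_interpolant ::
    "nat \<Rightarrow> element \<Rightarrow> (nat \<times> nat \<Rightarrow> real^3^3) \<Rightarrow> real^2 \<Rightarrow> real^3^3 \<Rightarrow> bool" where
  "geodesic_interpolant p T R \<xi> S \<longleftrightarrow>
     is_arg_min (\<lambda>S. \<Sum>a \<in> ref_indices p T. shape_fn p T a \<xi> * (geodesic_dist (R a) S)\<^sup>2)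
       (\<lambda>S. S \<in> SO3) S"

definition geodesic_fe_space :: "nat \<Rightarrow> (real^2) set \<Rightarrow> element set \<Rightarrow> (real^2 \<Rightarrow> real^3^3) set" where
  "geodesic_fe_space p \<omega> G =
     {R \<in> closure \<omega> \<rightarrow>\<^sub>E SO3. continuous_on (closure \<omega>) R \<and>
        (\<forall>T \<in> G. \<forall>x \<in> cell T.
           geodesic_interpolant p T (\<lambda>a. R (element_node p T a)) (to_ref T x) (R x))}"


section \<open>The algebraic shell energy\<close>

text \<open>Coefficient vectors with \<open>N\<close> entries are extensional functions on \<open>{1..N}\<close>, and the map
  \<open>nd\<close> enumerates the Lagrange nodes.\<close>

definition node_values :: "nat \<Rightarrow> (nat \<Rightarrow> real^2) \<Rightarrow> (real^2 \<Rightarrow> 'b) \<Rightarrow> nat \<Rightarrow> 'b" where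
  "node_values N nd f = (\<lambda>i\<in>{1..N}. f (nd i))"

definition gfe_coeffs ::
    "nat \<Rightarrow> (real^2) set \<Rightarrow> element set \<Rightarrow> nat \<Rightarrow> (nat \<Rightarrow> real^2) \<Rightarrow> (nat \<Rightarrow> real^3^3) set" where
  "gfe_coeffs p \<omega> G N nd =
     {c \<in> {1..N} \<rightarrow>\<^sub>E SO3. \<exists>!R. R \<in> geodesic_fe_space p \<omega> G \<and> node_values N nd R = c}"

definition algebraic_energy ::
    "real \<Rightarrow> real \<Rightarrow> real \<Rightarrow> real \<Rightarrow> real \<Rightarrow> real \<Rightarrow> real \<Rightarrow> (real^2) set \<Rightarrow> element set
     \<Rightarrow> nat \<Rightarrow> nat \<Rightarrow> (nat \<Rightarrow> real^2) \<Rightarrow> nat \<Rightarrow> nat \<Rightarrow> (nat \<Rightarrow> real^2)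
     \<Rightarrow> (nat \<Rightarrow> real^3) \<Rightarrow> (nat \<Rightarrow> real^3^3) \<Rightarrow> ennreal" where
  "algebraic_energy h \<mu> \<mu>c lam \<kappa> Lc q \<omega> G p1 N1 nd1 p2 N2 nd2 m R =
     shell_energy h \<mu> \<mu>c lam \<kappa> Lc q \<omega>
       (the_inv_into (lagrange_fe_space p1 \<omega> G) (node_values N1 nd1) m)
       (the_inv_into (geodesic_fe_space p2 \<omega> G) (node_values N2 nd2) R)"

end

theory Submission
  imports Defs
begin

text \<open>Frame invariance holds because discretization and energy are both equivariant under a rotation
  $Q$ acting from the left.

  The geodesic distance depends on $R_1^T R_2$ only, so it does not change when both arguments are
  multiplied by $Q$; therefore $Q$ maps minimizers of the weighted sum of squared distances to
  minimizers (\<open>geodesic_interpolant_rotated\<close>), and geodesic finite element functions to geodesic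
  finite element functions. Rotating back with $Q^T$ shows that the existence and uniqueness that
  define the admissible coefficients are preserved (\<open>gfe_coeffs_rotated\<close>). Lagrange finite element
  functions are equivariant because interpolation is linear (\<open>lagrange_coeffs_rotated\<close>).

  The energy density is built from products $(QA)^T (QB) = A^T B$, from inner products, and from a
  determinant that is multiplied by $\det Q = 1$ (\<open>W_mp_rotated\<close>, \<open>curvature_strain_rotated\<close>).

  Two facts behind this short argument carry most of the work. First, the density contains weak
  derivatives, of which an arbitrary representative is chosen. That the representative for $Qm$ is
  almost everywhere the rotated representative for $m$ is the uniqueness of weak derivatives, that
  is, \<open>fundamental_lemma_calculus_of_variations\<close>; its proof tests with explicit smooth functions that
  converge to indicator functions of boxes, and then differentiates integrals over cubes. Secondly,
  the algebraic energy refers to the finite element function with given nodal values, so it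
  must be known that there is exactly one (\<open>lagrange_fe_function_ex1\<close>). Uniqueness
  requires the maps from the reference element to be injective (\<open>inj_on_from_ref\<close>), which for
  quadrilaterals is a consequence of convexity; existence requires that the interpolants on
  neighbouring elements agree on the common edge (\<open>local_interpolants_agree_on_edge\<close>), where both
  are polynomials of degree $p$ with the same values at $p+1$ nodes.\<close>

section \<open>Smooth bump functions\<close>

lemma Ck_SucI:
  assumes "\<And>x. (f has_derivative f' x) (at x)" and "\<And>v. Ck k (\<lambda>x. f' x v)"
  shows "Ck (Suc k) f"
proof -
  have "frechet_derivative f (at x) = f' x" for x
    using frechet_derivative_at[OF assms(1)] by simp
  then show ?thesis
    using assms by (auto simp: differentiable_def)
qed

lemma Ck_SucD: "Ck (Suc k) f \<Longrightarrow> Ck k f"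
proof (induction k arbitrary: f)
  case 0
  then show ?case
    by (simp add: differentiable_imp_continuous_on differentiable_on_def differentiable_at_withinI)
next
  case (Suc k)
  then show ?case by (metis Ck.simps(2))
qed

lemma Ck_const: "Ck k (\<lambda>x. c)"
proof (induction k arbitrary: c)
  case (Suc k)
  then show ?case by (intro Ck_SucI[where f' = "\<lambda>x v. 0"]) auto
qed simp

lemma Ck_has_derivative:
  "Ck (Suc k) f \<Longrightarrow> (f has_derivative frechet_derivative f (at x)) (at x)"
  by (simp add: frechet_derivative_works)

lemma Ck_add: "Ck k f \<Longrightarrow> Ck k g \<Longrightarrow> Ck k (\<lambda>x. f x + g x)"
proof (induction k arbitrary: f g)
  case 0
  then show ?case by (simp add: continuous_on_add)
next
  case (Suc k)
  show ?case
    by (rule Ck_SucI[OF has_derivative_add[OF Ck_has_derivative[OF Suc.prems(1)]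
              Ck_has_derivative[OF Suc.prems(2)]]])
      (use Suc in simp)
qed

lemma Ck_mult: "Ck k f \<Longrightarrow> Ck k g \<Longrightarrow> Ck k (\<lambda>x. f x * g x)"
proof (induction k arbitrary: f g)
  case 0
  then show ?case by (simp add: continuous_on_mult)
next
  case (Suc k)
  show ?case
    by (rule Ck_SucI[OF has_derivative_mult[OF Ck_has_derivative[OF Suc.prems(1)]
              Ck_has_derivative[OF Suc.prems(2)]]])
      (intro Ck_add Suc.IH Ck_SucD[OF Suc.prems(1)] Ck_SucD[OF Suc.prems(2)]; use Suc.prems in simp)
qed

text \<open>The functions $P(1/t)\,e^{-1/t}$, extended by zero to $t \le 0$. They include the standard smooth
  but non-analytic function ($P = 1$), and their derivatives are again of this form, so that the
  smoothness of all of them follows by one induction.\<close>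

definition flat_exp :: "real poly \<Rightarrow> real \<Rightarrow> real" where
  "flat_exp P t = (if t \<le> 0 then 0 else poly P (1 / t) * exp (- 1 / t))"

text \<open>Read with $s = 1/t$, this is the flatness of \<open>flat_exp P\<close> at the origin.\<close>

lemma poly_times_exp_minus_tendsto_0: "((\<lambda>s. poly P s * exp (- s)) \<longlongrightarrow> (0::real)) at_top"
proof -
  have "((\<lambda>s. \<Sum>i\<le>degree P. coeff P i * (s ^ i / exp s)) \<longlongrightarrow> (\<Sum>i\<le>degree P. coeff P i * 0)) at_top"
    by (intro tendsto_sum tendsto_mult tendsto_const tendsto_power_div_exp_0)
  then show ?thesis
    by (simp add: poly_altdef sum_distrib_right exp_minus sum_divide_distrib field_simps)
qed

text \<open>For positive $t$ the chain rule gives the factor $t^{-2} (P - P')(1/t)$. At the origin the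
  difference quotient from the right is, with $s = 1/t$, a polynomial in $s$ times $e^{-s}$.\<close>

lemma flat_exp_has_derivative:
  "(flat_exp P has_real_derivative flat_exp ([:0, 0, 1:] * (P - pderiv P)) t) (at t)"
proof -
  consider "t < 0" | "t = 0" | "t > 0" by linarith
  then show ?thesis
  proof cases
    case 1
    have "((\<lambda>_. 0) has_real_derivative 0) (at t)" by simp
    then have "(flat_exp P has_real_derivative 0) (at t)"
      by (rule has_field_derivative_transform_within_open[where S = "{..<0}"])
        (use 1 in \<open>auto simp: flat_exp_def\<close>)
    then show ?thesis using 1 by (simp add: flat_exp_def)
  next
    case 2
    have "((\<lambda>s. flat_exp P s / s) \<longlongrightarrow> 0) (at_left 0)"
      by (rule tendsto_eventually) (auto simp: flat_exp_def eventually_at_filter)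
    moreover have "((\<lambda>s. flat_exp P s / s) \<longlongrightarrow> 0) (at_right 0)"
      unfolding filterlim_at_right_to_top
    proof (rule Lim_transform_eventually)
      show "((\<lambda>s. poly ([:0, 1:] * P) s * exp (- s)) \<longlongrightarrow> 0) at_top"
        by (rule poly_times_exp_minus_tendsto_0)
      show "\<forall>\<^sub>F s in at_top. poly ([:0, 1:] * P) s * exp (- s) =
          flat_exp P (inverse s) / inverse s"
        using eventually_gt_at_top[of 0]
        by eventually_elim (simp add: flat_exp_def field_simps)
    qed
    ultimately have "((\<lambda>s. flat_exp P s / s) \<longlongrightarrow> 0) (at 0)"
      by (simp add: filterlim_split_at)
    then show ?thesis
      using 2 by (simp add: has_field_derivative_iff flat_exp_def)
  next
    case 3
    have "((\<lambda>t. poly P (1 / t) * exp (- 1 / t)) has_real_derivative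
        poly ([:0, 0, 1:] * (P - pderiv P)) (1 / t) * exp (- 1 / t)) (at t)"
      using 3 by (auto intro!: derivative_eq_intros DERIV_chain'[OF _ poly_DERIV]
          simp: field_simps power2_eq_square)
    then have "(flat_exp P has_real_derivative
        poly ([:0, 0, 1:] * (P - pderiv P)) (1 / t) * exp (- 1 / t)) (at t)"
      by (rule has_field_derivative_transform_within_open[where S = "{0<..}"])
        (use 3 in \<open>auto simp: flat_exp_def\<close>)
    then show ?thesis using 3 by (simp add: flat_exp_def)
  qed
qed

lemma Ck_flat_exp_affine: "Ck k (\<lambda>x. flat_exp P (c \<bullet> x + d))"
proof (induction k arbitrary: P)
  case 0
  have "continuous_on UNIV (flat_exp P)"
    by (meson DERIV_isCont continuous_at_imp_continuous_on flat_exp_has_derivative)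
  then have "continuous_on UNIV (flat_exp P \<circ> (\<lambda>x. c \<bullet> x + d))"
    by (intro continuous_on_compose continuous_intros) (auto elim: continuous_on_subset)
  then show ?case by (simp add: o_def)
next
  case (Suc k)
  let ?Q = "[:0, 0, 1:] * (P - pderiv P)"
  have "((\<lambda>x. flat_exp P (c \<bullet> x + d)) has_derivative
      (\<lambda>v. flat_exp ?Q (c \<bullet> x + d) * (c \<bullet> v))) (at x)" for x
  proof -
    have "((\<lambda>x. c \<bullet> x + d) has_derivative (\<lambda>v. c \<bullet> v)) (at x)"
      by (auto intro!: derivative_eq_intros)
    from has_derivative_compose[OF this
        flat_exp_has_derivative[of P "c \<bullet> x + d", unfolded has_field_derivative_def]]
    show ?thesis by simp
  qed
  then show ?case
    by (rule Ck_SucI) (intro Ck_mult Suc.IH Ck_const)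
qed

text \<open>Each coordinate contributes the factor $e^{-1/((n+1)(x_i-a_i))}\,e^{-1/((n+1)(b_i-x_i))}$
  inside the box. Scaling the arguments by $n+1$ leaves the support fixed and pushes the values to 1, which
  gives smooth approximations of the indicator function of a box without any mollification.\<close>

definition box_bump :: "real^2 \<Rightarrow> real^2 \<Rightarrow> nat \<Rightarrow> real^2 \<Rightarrow> real" where
  "box_bump a b n x =
     (\<Prod>i\<in>UNIV. flat_exp 1 (real (Suc n) * (x $ i - a $ i)) * flat_exp 1 (real (Suc n) * (b $ i - x $ i)))"

lemma flat_exp_1_bounds: "0 \<le> flat_exp 1 t" "flat_exp 1 t \<le> 1"
  by (auto simp: flat_exp_def)

lemma smooth_box_bump: "smooth (box_bump a b n)"
proof -
  have "Ck k (\<lambda>x. flat_exp 1 (real (Suc n) * (x $ i - a $ i)))" for k i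
    using Ck_flat_exp_affine[of k 1 "real (Suc n) *\<^sub>R axis i 1" "- real (Suc n) * a $ i"]
    by (simp add: inner_axis' algebra_simps)
  moreover have "Ck k (\<lambda>x. flat_exp 1 (real (Suc n) * (b $ i - x $ i)))" for k i
    using Ck_flat_exp_affine[of k 1 "- real (Suc n) *\<^sub>R axis i 1" "real (Suc n) * b $ i"]
    by (simp add: inner_axis' algebra_simps)
  ultimately show ?thesis
    unfolding smooth_def box_bump_def prod.distrib[symmetric] UNIV_2
    by (simp add: Ck_mult)
qed

lemma box_bump_eq_0: "x \<notin> box a b \<Longrightarrow> box_bump a b n x = 0"
  by (auto simp: box_bump_def mem_box_cart flat_exp_def not_less mult_le_0_iff
      intro!: prod_zero)

lemma box_bump_bounds: "0 \<le> box_bump a b n x" "box_bump a b n x \<le> 1"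
  unfolding box_bump_def
  by (intro prod_nonneg ballI mult_nonneg_nonneg flat_exp_1_bounds)
    (intro prod_le_1 conjI mult_nonneg_nonneg mult_le_one flat_exp_1_bounds)

lemma box_bump_tendsto: "(\<lambda>n. box_bump a b n x) \<longlonglongrightarrow> indicator (box a b) x"
proof (cases "x \<in> box a b")
  case True
  have lim: "(\<lambda>n. flat_exp 1 (real (Suc n) * s)) \<longlonglongrightarrow> 1" if "s > 0" for s :: real
  proof -
    have "(\<lambda>n. exp (- (1 / s) * inverse (real (Suc n)))) \<longlonglongrightarrow> exp (- (1 / s) * 0)"
      by (intro tendsto_intros LIMSEQ_inverse_real_of_nat)
    moreover have "flat_exp 1 (real (Suc n) * s) = exp (- (1 / s) * inverse (real (Suc n)))" for n
    proof -
      have "0 < real (Suc n) * s" using that by simp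
      then show ?thesis by (simp add: flat_exp_def field_simps del: of_nat_Suc)
    qed
    ultimately show ?thesis by simp
  qed
  have "(\<lambda>n. box_bump a b n x) \<longlonglongrightarrow> (\<Prod>i\<in>(UNIV::2 set). 1 * 1)"
    unfolding box_bump_def
    by (intro tendsto_prod tendsto_mult lim) (use True in \<open>auto simp: mem_box_cart\<close>)
  then show ?thesis using True by simp
qed (simp add: box_bump_eq_0)

lemma test_function_box_bump: "cbox a b \<subseteq> \<omega> \<Longrightarrow> test_function \<omega> (box_bump a b n)"
  unfolding test_function_def
  using smooth_box_bump subsetD[OF box_subset_cbox[of a b]]
  by (intro conjI exI[of _ "cbox a b"]) (auto intro!: box_bump_eq_0)

section \<open>Almost everywhere uniqueness of weak derivatives\<close>

text \<open>A continuous function with compact support in the domain is bounded, so its product with \<open>u\<close> is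
  dominated by a multiple of \<open>u\<close> on the support. This is what allows linear maps to be pulled out of
  the integrals that define weak derivatives.\<close>

lemma integrable_test_scaleR:
  fixes u :: "real^2 \<Rightarrow> 'b::euclidean_space"
  assumes "locally_integrable \<omega> u" and "open \<omega>" and "compact K" and "K \<subseteq> \<omega>"
    and "continuous_on UNIV \<psi>" and "\<And>x. x \<notin> K \<Longrightarrow> \<psi> x = 0"
  shows "integrable (lebesgue_on \<omega>) (\<lambda>x. \<psi> x *\<^sub>R u x)"
proof -
  have K: "K \<in> sets lebesgue" and \<omega>: "\<omega> \<in> sets lebesgue"
    using assms by (auto simp: compact_imp_closed)
  have u: "integrable (lebesgue_on K) u"
    using assms by (simp add: locally_integrable_def)
  have "bounded (\<psi> ` K)"
    using assms by (meson compact_continuous_image compact_imp_bounded continuous_on_subset subset_UNIV)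
  then obtain B where B: "\<And>x. x \<in> K \<Longrightarrow> \<bar>\<psi> x\<bar> \<le> B"
    by (auto simp: bounded_iff)
  have meas: "\<psi> \<in> borel_measurable (lebesgue_on K)"
    using assms by (intro continuous_imp_measurable_on_sets_lebesgue K) (auto elim: continuous_on_subset)
  have "integrable (lebesgue_on K) (\<lambda>x. \<psi> x *\<^sub>R u x)"
  proof (rule Bochner_Integration.integrable_bound)
    show "integrable (lebesgue_on K) (\<lambda>x. B *\<^sub>R u x)"
      using u by simp
    show "(\<lambda>x. \<psi> x *\<^sub>R u x) \<in> borel_measurable (lebesgue_on K)"
      using meas u by (intro borel_measurable_scaleR) auto
    have "norm (\<psi> x *\<^sub>R u x) \<le> norm (B *\<^sub>R u x)" if "x \<in> K" for x
      using B[OF that] by (auto intro!: mult_right_mono)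
    then show "AE x in lebesgue_on K. norm (\<psi> x *\<^sub>R u x) \<le> norm (B *\<^sub>R u x)"
      by (intro AE_I2) auto
  qed
  then have "integrable lebesgue (\<lambda>x. if x \<in> K then \<psi> x *\<^sub>R u x else 0)"
    by (simp add: Lebesgue_Measure.integrable_restrict_UNIV[OF K])
  also have "(\<lambda>x. if x \<in> K then \<psi> x *\<^sub>R u x else 0) = (\<lambda>x. if x \<in> \<omega> then \<psi> x *\<^sub>R u x else 0)"
    using assms(4,6) by fastforce
  finally show ?thesis
    by (simp add: Lebesgue_Measure.integrable_restrict_UNIV[OF \<omega>])
qed

lemma continuous_on_test_function: "test_function \<omega> \<phi> \<Longrightarrow> continuous_on UNIV \<phi>"
  by (auto simp: test_function_def smooth_def dest: spec[of _ 0])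

lemma integrable_test_function_scaleR:
  assumes "locally_integrable \<omega> u" and "open \<omega>" and "test_function \<omega> \<phi>"
  shows "integrable (lebesgue_on \<omega>) (\<lambda>x. \<phi> x *\<^sub>R u x)"
proof -
  obtain K where "compact K" "K \<subseteq> \<omega>" "\<And>x. x \<notin> K \<Longrightarrow> \<phi> x = 0"
    using assms by (auto simp: test_function_def)
  then show ?thesis
    using assms by (intro integrable_test_scaleR[of \<omega> u K] continuous_on_test_function[of \<omega>])
qed

lemma integrable_partial_deriv_test_function_scaleR:
  assumes "locally_integrable \<omega> u" and "open \<omega>" and \<phi>: "test_function \<omega> \<phi>"
  shows "integrable (lebesgue_on \<omega>) (\<lambda>x. partial_deriv i \<phi> x *\<^sub>R u x)"
proof -
  obtain K where K: "compact K" "K \<subseteq> \<omega>" "\<And>x. x \<notin> K \<Longrightarrow> \<phi> x = 0"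
    using assms by (auto simp: test_function_def)
  have "Ck 1 \<phi>"
    using \<phi> by (simp only: test_function_def smooth_def)
  then have cont: "continuous_on UNIV (partial_deriv i \<phi>)"
    by (simp add: partial_deriv_def[abs_def])
  have "partial_deriv i \<phi> x = 0" if "x \<notin> K" for x
  proof -
    have "((\<lambda>_. 0) has_derivative (\<lambda>_. 0)) (at x)"
      by simp
    then have "(\<phi> has_derivative (\<lambda>_. 0)) (at x)"
      by (rule has_derivative_transform_within_open[where s = "- K"])
        (use K that in \<open>auto simp: compact_imp_closed open_Compl\<close>)
    then show ?thesis
      by (simp add: partial_deriv_def frechet_derivative_at[symmetric])
  qed
  then show ?thesis
    using assms K cont by (intro integrable_test_scaleR[of \<omega> u K])
qed

text \<open>The functions \<open>box_bump a b n\<close> are admissible test functions, are bounded by 1, and converge to the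
  indicator function of the open box; dominated convergence turns the vanishing of their integrals
  against \<open>u\<close> into the vanishing of the integral of \<open>u\<close> over the box.\<close>

lemma integral_cbox_eq_0:
  fixes u :: "real^2 \<Rightarrow> 'b::euclidean_space"
  assumes u: "locally_integrable \<omega> u" and "open \<omega>" and sub: "cbox a b \<subseteq> \<omega>"
    and zero: "\<And>\<phi>. test_function \<omega> \<phi> \<Longrightarrow> (LINT x|lebesgue_on \<omega>. \<phi> x *\<^sub>R u x) = 0"
  shows "integral (cbox a b) u = 0"
proof -
  have \<omega>: "\<omega> \<in> sets lebesgue" using assms by auto
  have int: "integrable (lebesgue_on (cbox a b)) u"
    using u sub by (simp add: locally_integrable_def)
  then have int_UNIV: "integrable lebesgue (\<lambda>x. if x \<in> cbox a b then u x else 0)"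
    by (simp add: Lebesgue_Measure.integrable_restrict_UNIV)
  have meas: "(\<lambda>x. if x \<in> cbox a b then u x else 0) \<in> borel_measurable lebesgue"
    using int_UNIV by auto
  have box: "box a b \<in> sets lebesgue" by auto
  have bump: "(LINT x|lebesgue. box_bump a b n x *\<^sub>R (if x \<in> cbox a b then u x else 0)) = 0" for n
  proof -
    have "(\<lambda>x. box_bump a b n x *\<^sub>R (if x \<in> cbox a b then u x else 0)) =
        (\<lambda>x. if x \<in> \<omega> then box_bump a b n x *\<^sub>R u x else 0)"
      using sub box_bump_eq_0[of _ a b n] box_subset_cbox[of a b] by fastforce
    then show ?thesis
      using zero[OF test_function_box_bump[OF sub]]
      by (simp add: Lebesgue_Measure.integral_restrict_UNIV[OF \<omega>])
  qed
  have "(\<lambda>n. LINT x|lebesgue. box_bump a b n x *\<^sub>R (if x \<in> cbox a b then u x else 0)) \<longlonglongrightarrow>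
      (LINT x|lebesgue. indicator (box a b) x *\<^sub>R (if x \<in> cbox a b then u x else 0))"
  proof (rule integral_dominated_convergence)
    show "integrable lebesgue (\<lambda>x. norm (if x \<in> cbox a b then u x else 0))"
      using int_UNIV by (rule integrable_norm)
    show "(\<lambda>x. indicator (box a b) x *\<^sub>R (if x \<in> cbox a b then u x else 0)) \<in> borel_measurable lebesgue"
      using meas box by (intro borel_measurable_scaleR borel_measurable_indicator)
    have "box_bump a b n \<in> borel_measurable lebesgue" for n
      using continuous_on_test_function[OF test_function_box_bump[OF sub]]
      by (simp add: borel_measurable_continuous_onI measurable_completion)
    then show "(\<lambda>x. box_bump a b n x *\<^sub>R (if x \<in> cbox a b then u x else 0)) \<in> borel_measurable lebesgue" for n
      using meas by (intro borel_measurable_scaleR)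
    show "AE x in lebesgue. (\<lambda>n. box_bump a b n x *\<^sub>R (if x \<in> cbox a b then u x else 0)) \<longlonglongrightarrow>
        indicator (box a b) x *\<^sub>R (if x \<in> cbox a b then u x else 0)"
      by (intro AE_I2 tendsto_scaleR box_bump_tendsto tendsto_const)
    show "AE x in lebesgue. norm (box_bump a b n x *\<^sub>R (if x \<in> cbox a b then u x else 0)) \<le>
        norm (if x \<in> cbox a b then u x else 0)" for n
      using box_bump_bounds[of a b n] by (intro AE_I2) (simp add: mult_left_le_one_le)
  qed
  then have "(LINT x|lebesgue. indicator (box a b) x *\<^sub>R (if x \<in> cbox a b then u x else 0)) = 0"
    by (simp add: bump LIMSEQ_const_iff)
  moreover have "integrable lebesgue (\<lambda>x. indicator (box a b) x *\<^sub>R (if x \<in> cbox a b then u x else 0))"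
    using box int_UNIV by (rule integrable_mult_indicator)
  moreover have "(\<lambda>x. indicator (box a b) x *\<^sub>R (if x \<in> cbox a b then u x else 0)) =
      (\<lambda>x. if x \<in> box a b then u x else 0)"
    using box_subset_cbox[of a b] by (fastforce simp: indicator_def)
  ultimately have "(LINT x|lebesgue_on (box a b). u x) = 0" and "integrable (lebesgue_on (box a b)) u"
    by (simp_all add: Lebesgue_Measure.integral_restrict_UNIV[OF box]
        Lebesgue_Measure.integrable_restrict_UNIV[OF box])
  then have "integral (box a b) u = 0"
    using lebesgue_integral_eq_integral[OF _ box, of u] by simp
  then show ?thesis by (simp add: integral_open_interval)
qed

text \<open>By Lebesgue's differentiation theorem, at almost every point the value of \<open>u\<close> is the limit of its
  averages over small cubes with this point as a corner, and all these averages vanish.\<close>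

lemma negligible_nonzero_in_cbox:
  fixes u :: "real^2 \<Rightarrow> 'b::euclidean_space"
  assumes u: "u integrable_on cbox a b"
    and zero: "\<And>c d. cbox c d \<subseteq> cbox a b \<Longrightarrow> integral (cbox c d) u = 0"
  shows "negligible {x \<in> cbox a b. u x \<noteq> 0}"
proof -
  let ?v = "\<lambda>x. if x \<in> cbox a b then u x else 0"
  have "?v integrable_on cbox c d" for c d
    using u by (intro integrable_on_subcbox[of _ UNIV])
      (simp_all add: Henstock_Kurzweil_Integration.integrable_restrict_UNIV)
  then obtain N where N: "negligible N"
    "\<And>x e. \<lbrakk>x \<notin> N; 0 < e\<rbrakk> \<Longrightarrow> \<exists>d>0. \<forall>h. 0 < h \<and> h < d \<longrightarrow>
       norm (integral (cbox x (x + h *\<^sub>R One)) ?v /\<^sub>R h ^ DIM(real^2) - ?v x) < e"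
    using integrable_ccontinuous_explicit[of ?v] by blast
  have "u x = 0" if x: "x \<in> box a b" "x \<notin> N" for x
  proof (rule ccontr)
    assume "u x \<noteq> 0"
    then obtain d where d: "d > 0" "\<And>h. \<lbrakk>0 < h; h < d\<rbrakk> \<Longrightarrow>
       norm (integral (cbox x (x + h *\<^sub>R One)) ?v /\<^sub>R h ^ DIM(real^2) - ?v x) < norm (u x)"
      using N(2)[OF x(2), of "norm (u x)"] by auto
    obtain e where e: "e > 0" "ball x e \<subseteq> box a b"
      using x(1) open_box open_contains_ball by blast
    \<comment> \<open>A cube of side \<open>h\<close> has points at distance at most $\sum_i h = 2h$ from its corner.\<close>
    define h where "h = min (d / 2) (e / 2 / DIM(real^2))"
    have h: "0 < h" "h < d" "h * DIM(real^2) < e"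
      using d(1) e(1) by (auto simp: h_def)
    have "cbox x (x + h *\<^sub>R One) \<subseteq> ball x e"
    proof
      fix y assume y: "y \<in> cbox x (x + h *\<^sub>R One)"
      have "dist x y \<le> (\<Sum>i\<in>Basis. \<bar>(x - y) \<bullet> i\<bar>)"
        unfolding dist_norm by (rule norm_le_l1)
      also have "\<dots> \<le> (\<Sum>i\<in>(Basis :: (real^2) set). h)"
        using y by (intro sum_mono) (auto simp: mem_box inner_simps)
      also have "\<dots> < e" using h by (simp add: mult.commute)
      finally show "y \<in> ball x e" by simp
    qed
    then have sub: "cbox x (x + h *\<^sub>R One) \<subseteq> cbox a b"
      using e(2) box_subset_cbox by blast
    have "integral (cbox x (x + h *\<^sub>R One)) ?v = integral (cbox x (x + h *\<^sub>R One)) u"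
      using sub by (intro Henstock_Kurzweil_Integration.integral_cong) auto
    also have "\<dots> = 0" by (rule zero[OF sub])
    finally show False
      using d(2)[OF h(1,2)] x(1) box_subset_cbox[of a b] by (auto split: if_splits)
  qed
  then have "{x \<in> cbox a b. u x \<noteq> 0} \<subseteq> N \<union> (cbox a b - box a b)"
    by auto
  then show ?thesis
    using N(1) negligible_frontier_interval negligible_Un negligible_subset by blast
qed

text \<open>The fundamental lemma of the calculus of variations: an open set is a countable union of closed
  boxes, and in each of them \<open>u\<close> vanishes almost everywhere because all its box integrals do.\<close>

lemma fundamental_lemma_calculus_of_variations:
  fixes u :: "real^2 \<Rightarrow> 'b::euclidean_space"
  assumes u: "locally_integrable \<omega> u" and \<omega>: "open \<omega>"
    and zero: "\<And>\<phi>. test_function \<omega> \<phi> \<Longrightarrow> (LINT x|lebesgue_on \<omega>. \<phi> x *\<^sub>R u x) = 0"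
  shows "AE x in lebesgue_on \<omega>. u x = 0"
proof -
  obtain \<D> where D: "countable \<D>" "\<D> \<subseteq> Pow \<omega>" "\<And>X. X \<in> \<D> \<Longrightarrow> \<exists>a b. X = cbox a b" "\<Union>\<D> = \<omega>"
    by (rule open_countable_Union_open_cbox[OF \<omega>]) (rule that)
  have "negligible {x \<in> X. u x \<noteq> 0}" if mem: "X \<in> \<D>" for X
  proof -
    obtain a b where X: "X = cbox a b" "cbox a b \<subseteq> \<omega>" using D(2,3) mem by blast
    have "integrable (lebesgue_on (cbox a b)) u"
      using u X by (simp add: locally_integrable_def)
    then have "u integrable_on cbox a b"
      by (rule integrable_on_lebesgue_on) auto
    then show ?thesis
      unfolding X(1)
      by (rule negligible_nonzero_in_cbox) (use X(2) in \<open>auto intro!: integral_cbox_eq_0[OF u \<omega> _ zero]\<close>)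
  qed
  then have "negligible (\<Union>X\<in>\<D>. {x \<in> X. u x \<noteq> 0})"
    using D(1) by (intro negligible_countable_Union) auto
  also have "(\<Union>X\<in>\<D>. {x \<in> X. u x \<noteq> 0}) = {x \<in> \<omega>. u x \<noteq> 0}"
    using D(4) by auto
  finally have "AE x in lebesgue. x \<in> \<omega> \<longrightarrow> u x = 0"
    by (intro AE_I'[of "{x \<in> \<omega>. u x \<noteq> 0}"]) (auto simp: negligible_iff_null_sets)
  then show ?thesis
    using \<omega> by (subst AE_restrict_space_iff) auto
qed

lemma is_weak_partial_unique:
  fixes u :: "real^2 \<Rightarrow> 'b::euclidean_space"
  assumes "open \<omega>" and g: "is_weak_partial \<omega> i u g" and g': "is_weak_partial \<omega> i u g'"
  shows "AE x in lebesgue_on \<omega>. g x = g' x"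
proof -
  have "locally_integrable \<omega> (\<lambda>x. g x - g' x)"
    using g g' by (auto simp: is_weak_partial_def locally_integrable_def)
  moreover have "(LINT x|lebesgue_on \<omega>. \<phi> x *\<^sub>R (g x - g' x)) = 0" if "test_function \<omega> \<phi>" for \<phi>
  proof -
    have "(LINT x|lebesgue_on \<omega>. \<phi> x *\<^sub>R g x) = (LINT x|lebesgue_on \<omega>. \<phi> x *\<^sub>R g' x)"
      using g g' that by (simp add: is_weak_partial_def)
    moreover have "integrable (lebesgue_on \<omega>) (\<lambda>x. \<phi> x *\<^sub>R g x)"
      "integrable (lebesgue_on \<omega>) (\<lambda>x. \<phi> x *\<^sub>R g' x)"
      using g g' that assms(1) by (auto simp: is_weak_partial_def intro!: integrable_test_function_scaleR)
    ultimately show ?thesis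
      by (simp add: scaleR_diff_right)
  qed
  ultimately have "AE x in lebesgue_on \<omega>. g x - g' x = 0"
    using assms(1) by (intro fundamental_lemma_calculus_of_variations)
  then show ?thesis by simp
qed

section \<open>Linear maps and Sobolev spaces\<close>

lemma locally_integrable_bounded_linear:
  assumes "bounded_linear L" and u: "locally_integrable \<omega> u" and "\<And>x. x \<in> \<omega> \<Longrightarrow> v x = L (u x)"
  shows "locally_integrable \<omega> v"
  unfolding locally_integrable_def
proof (intro allI impI)
  fix K assume K: "compact K \<and> K \<subseteq> \<omega>"
  then have "integrable (lebesgue_on K) (\<lambda>x. L (u x))"
    using u by (intro integrable_bounded_linear[OF assms(1)]) (simp add: locally_integrable_def)
  then show "integrable (lebesgue_on K) v"
    by (rule Bochner_Integration.integrable_cong[THEN iffD2, rotated 2])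
      (use K assms(3) in auto)
qed

text \<open>The function \<open>v\<close> is compared with \<open>u\<close> on the domain only: outside the closed domain,
  finite element functions take a default value, which rotations do not preserve.\<close>

lemma is_weak_partial_bounded_linear:
  fixes u g :: "real^2 \<Rightarrow> 'b::euclidean_space" and v k :: "real^2 \<Rightarrow> 'c::euclidean_space"
  assumes \<omega>: "open \<omega>" and L: "bounded_linear L" and g: "is_weak_partial \<omega> i u g"
    and v: "\<And>x. x \<in> \<omega> \<Longrightarrow> v x = L (u x)" and k: "\<And>x. x \<in> \<omega> \<Longrightarrow> k x = L (g x)"
  shows "is_weak_partial \<omega> i v k"
  unfolding is_weak_partial_def
proof (intro conjI allI impI)
  have u: "locally_integrable \<omega> u" "locally_integrable \<omega> g"
    using g by (auto simp: is_weak_partial_def)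
  show "locally_integrable \<omega> v"
    by (rule locally_integrable_bounded_linear[OF L u(1)]) (rule v)
  show "locally_integrable \<omega> k"
    by (rule locally_integrable_bounded_linear[OF L u(2)]) (rule k)
  fix \<phi> assume \<phi>: "test_function \<omega> \<phi>"
  interpret L: bounded_linear L by fact
  have "(LINT x|lebesgue_on \<omega>. partial_deriv i \<phi> x *\<^sub>R v x) =
      (LINT x|lebesgue_on \<omega>. L (partial_deriv i \<phi> x *\<^sub>R u x))"
    by (intro Bochner_Integration.integral_cong) (auto simp: v L.scaleR)
  also have "\<dots> = L (LINT x|lebesgue_on \<omega>. partial_deriv i \<phi> x *\<^sub>R u x)"
    by (intro integral_bounded_linear L integrable_partial_deriv_test_function_scaleR u \<omega> \<phi>)
  also have "\<dots> = L (- (LINT x|lebesgue_on \<omega>. \<phi> x *\<^sub>R g x))"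
    using g \<phi> by (simp add: is_weak_partial_def)
  also have "\<dots> = - (LINT x|lebesgue_on \<omega>. L (\<phi> x *\<^sub>R g x))"
    by (simp add: L.neg integral_bounded_linear[OF L
          integrable_test_function_scaleR[OF u(2) \<omega> \<phi>]])
  also have "(LINT x|lebesgue_on \<omega>. L (\<phi> x *\<^sub>R g x)) = (LINT x|lebesgue_on \<omega>. \<phi> x *\<^sub>R k x)"
    by (intro Bochner_Integration.integral_cong) (auto simp: k L.scaleR)
  finally show "(LINT x|lebesgue_on \<omega>. partial_deriv i \<phi> x *\<^sub>R v x) =
      - (LINT x|lebesgue_on \<omega>. \<phi> x *\<^sub>R k x)" .
qed

text \<open>Both sides are weak derivatives of \<open>v\<close>. The representative chosen by \<^const>\<open>weak_partial\<close> does not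
  commute with \<open>L\<close> in general, so only equality almost everywhere can hold, and it requires uniqueness
  of weak derivatives.\<close>

lemma weak_partial_bounded_linear:
  fixes u :: "real^2 \<Rightarrow> 'b::euclidean_space" and v :: "real^2 \<Rightarrow> 'c::euclidean_space"
  assumes \<omega>: "open \<omega>" and L: "bounded_linear L" and "is_weak_partial \<omega> i u g"
    and v: "\<And>x. x \<in> \<omega> \<Longrightarrow> v x = L (u x)"
  shows "AE x in lebesgue_on \<omega>. weak_partial \<omega> i v x = L (weak_partial \<omega> i u x)"
proof -
  have "is_weak_partial \<omega> i u (weak_partial \<omega> i u)"
    unfolding weak_partial_def using assms(3) by (rule someI[where P = "is_weak_partial \<omega> i u"])
  then have w: "is_weak_partial \<omega> i v (\<lambda>x. L (weak_partial \<omega> i u x))"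
    by (rule is_weak_partial_bounded_linear[OF \<omega> L]) (use v in auto)
  moreover have "is_weak_partial \<omega> i v (weak_partial \<omega> i v)"
    unfolding weak_partial_def using w by (rule someI[where P = "is_weak_partial \<omega> i v"])
  ultimately show ?thesis
    using is_weak_partial_unique[OF \<omega>] by blast
qed

lemma Lebesgue_space_isometry:
  assumes L: "bounded_linear L" and norm: "\<And>y. norm (L y) = norm y"
    and u: "u \<in> Lebesgue_space q \<omega>" and v: "\<And>x. x \<in> \<omega> \<Longrightarrow> v x = L (u x)"
  shows "v \<in> Lebesgue_space q \<omega>"
proof -
  have "(\<lambda>x. L (u x)) \<in> borel_measurable (lebesgue_on \<omega>)"
    using u borel_measurable_continuous_onI[OF linear_continuous_on[OF L]]
    by (auto simp: Lebesgue_space_def intro: measurable_compose)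
  then have "v \<in> borel_measurable (lebesgue_on \<omega>)"
    by (rule measurable_cong[THEN iffD2, rotated]) (simp add: v)
  moreover have "integrable (lebesgue_on \<omega>) (\<lambda>x. norm (u x) powr q)"
    using u by (simp add: Lebesgue_space_def)
  then have "integrable (lebesgue_on \<omega>) (\<lambda>x. norm (v x) powr q)"
    by (rule Bochner_Integration.integrable_cong[THEN iffD2, rotated 2]) (simp_all add: v norm)
  ultimately show ?thesis by (simp add: Lebesgue_space_def)
qed

lemma Sobolev_1_isometry:
  assumes \<omega>: "open \<omega>" and L: "bounded_linear L" and norm: "\<And>y. norm (L y) = norm y"
    and u: "u \<in> Sobolev_1 q \<omega>" and v: "\<And>x. x \<in> \<omega> \<Longrightarrow> v x = L (u x)"
  shows "v \<in> Sobolev_1 q \<omega>"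
proof -
  have "\<exists>g \<in> Lebesgue_space q \<omega>. is_weak_partial \<omega> i v g" for i
  proof -
    obtain g where g: "g \<in> Lebesgue_space q \<omega>" "is_weak_partial \<omega> i u g"
      using u by (auto simp: Sobolev_1_def)
    show ?thesis
    proof (rule bexI)
      show "is_weak_partial \<omega> i v (\<lambda>x. L (g x))"
        by (rule is_weak_partial_bounded_linear[OF \<omega> L g(2) v]) auto
      show "(\<lambda>x. L (g x)) \<in> Lebesgue_space q \<omega>"
        by (rule Lebesgue_space_isometry[OF L norm g(1)]) auto
    qed
  qed
  moreover have "u \<in> Lebesgue_space q \<omega>"
    using u by (simp add: Sobolev_1_def)
  then have "v \<in> Lebesgue_space q \<omega>"
    by (rule Lebesgue_space_isometry[OF L norm _ v])
  ultimately show ?thesis by (simp add: Sobolev_1_def)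
qed

section \<open>Rotations\<close>

lemma SO3_iff: "Q \<in> SO3 \<longleftrightarrow> orthogonal_matrix Q \<and> det Q = 1"
  by (simp add: SO3_def rotation_matrix_def)

lemma SO3_transpose: "Q \<in> SO3 \<Longrightarrow> transpose Q \<in> SO3"
  by (simp add: SO3_iff)

lemma SO3_mult: "Q \<in> SO3 \<Longrightarrow> R \<in> SO3 \<Longrightarrow> Q ** R \<in> SO3"
  by (simp add: SO3_iff orthogonal_matrix_mul det_mul)

lemma SO3_cancel_left:
  assumes "Q \<in> SO3"
  shows "transpose Q ** (Q ** A) = A" "Q ** (transpose Q ** A) = A"
    "transpose Q *v (Q *v x) = x" "Q *v (transpose Q *v x) = x"
  using assms by (simp_all add: SO3_iff orthogonal_matrix_def matrix_mul_assoc matrix_vector_mul_assoc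
      del: transpose_matrix_vector)

lemma transpose_mult_rotated:
  assumes "Q \<in> SO3"
  shows "transpose (Q ** A) ** (Q ** B) = transpose A ** B"
  using SO3_cancel_left(1)[OF assms, of B] by (simp add: matrix_transpose_mul matrix_mul_assoc[symmetric])

lemma inner_rotated:
  assumes "Q \<in> SO3"
  shows "(Q *v x) \<bullet> (Q *v y) = x \<bullet> y"
  using assms by (metis SO3_cancel_left(3) dot_lmul_matrix inner_commute transpose_matrix_vector)

lemma norm_rotated_vector:
  assumes "Q \<in> SO3"
  shows "norm (Q *v x) = norm x"
  by (simp add: norm_eq_sqrt_inner inner_rotated[OF assms])

lemma column_matrix_mult: "column i (Q ** A) = Q *v column i A"
  by (simp add: vec_eq_iff column_def matrix_matrix_mult_def matrix_vector_mult_def)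

text \<open>The squared Frobenius norm is the sum of the squared norms of the columns, and each column is
  rotated.\<close>

lemma norm_rotated_matrix:
  fixes A :: "real^3^3"
  assumes "Q \<in> SO3"
  shows "norm (Q ** A) = norm A"
proof -
  have cols: "B \<bullet> B = (\<Sum>j\<in>UNIV. column j B \<bullet> column j B)" for B :: "real^3^3"
    unfolding inner_vec_def column_def by (subst sum.swap) simp
  show ?thesis
    by (simp add: norm_eq_sqrt_inner cols column_matrix_mult inner_rotated[OF assms])
qed

lemma bounded_linear_matrix_mult: "bounded_linear (\<lambda>A. Q ** A :: real^3^3)"
  unfolding linear_conv_bounded_linear[symmetric]
  by (rule linearI) (simp_all add: vec_eq_iff matrix_matrix_mult_def
      distrib_left sum.distrib sum_distrib_left mult.left_commute)

lemma bounded_linear_column: "bounded_linear (\<lambda>A :: real^3^3. column i A)"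
  unfolding linear_conv_bounded_linear[symmetric]
  by (rule linearI) (simp_all add: column_def vec_eq_iff)

lemma cols2_rotated: "cols2 (Q *v a) (Q *v b) = Q ** cols2 a b"
  by (simp add: cols2_def vec_eq_iff transpose_def matrix_matrix_mult_def matrix_vector_mult_def forall_2)

lemma cols3_rotated: "cols3 (Q *v a) (Q *v b) (Q *v c) = Q ** cols3 a b c"
  by (simp add: cols3_def vec_eq_iff transpose_def matrix_matrix_mult_def matrix_vector_mult_def forall_3)

section \<open>Invariance of the continuous energy\<close>

text \<open>The membrane energy depends on its arguments through products $A^T B$ of rotated matrices, inner
  products of rotated vectors, and a determinant that is multiplied by $\det Q = 1$.\<close>

lemma W_mp_rotated:
  assumes "Q \<in> SO3"
  shows "W_mp \<mu> \<mu>c lam \<kappa> (Q *v mx) (Q *v my) (Q ** R) = W_mp \<mu> \<mu>c lam \<kappa> mx my R"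
proof -
  have "det Q = 1" using assms by (simp add: SO3_iff)
  then show ?thesis
    using assms unfolding W_mp_def Let_def
    by (simp add: column_matrix_mult cols2_rotated cols3_rotated transpose_mult_rotated
        inner_rotated det_mul)
qed

text \<open>The rotation cancels in $(QR)^T (Q\,\partial_x R_i \,|\, Q\,\partial_y R_i \,|\, 0)$, once the
  weak derivatives of the columns of $QR$ have been identified with the rotated ones.\<close>

lemma curvature_strain_rotated:
  assumes \<omega>: "open \<omega>" and Q: "Q \<in> SO3" and R: "R \<in> Sobolev_1 q \<omega>"
    and S: "\<And>x. x \<in> \<omega> \<Longrightarrow> S x = Q ** R x"
  shows "AE x in lebesgue_on \<omega>. curvature_strain \<omega> S i x = curvature_strain \<omega> R i x"
proof -
  have ae: "AE x in lebesgue_on \<omega>. weak_partial \<omega> j (\<lambda>y. column i (S y)) x =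
      Q *v weak_partial \<omega> j (\<lambda>y. column i (R y)) x" for j
  proof -
    obtain g where "is_weak_partial \<omega> j R g"
      using R by (auto simp: Sobolev_1_def)
    then have "is_weak_partial \<omega> j (\<lambda>y. column i (R y)) (\<lambda>y. column i (g y))"
      by (rule is_weak_partial_bounded_linear[OF \<omega> bounded_linear_column]) auto
    then show ?thesis
      by (rule weak_partial_bounded_linear[OF \<omega> matrix_vector_mul_bounded_linear])
        (simp add: S column_matrix_mult)
  qed
  have "AE x in lebesgue_on \<omega>. x \<in> \<omega>"
    by (rule AE_I2) simp
  with ae[of 1] ae[of 2] show ?thesis
  proof eventually_elim
    case (elim x)
    then have "curvature_strain \<omega> S i x = transpose (Q ** R x) **
        cols3 (Q *v weak_partial \<omega> 1 (\<lambda>y. column i (R y)) x)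
          (Q *v weak_partial \<omega> 2 (\<lambda>y. column i (R y)) x) (Q *v 0)"
      by (simp add: curvature_strain_def S)
    then show ?case
      by (simp only: cols3_rotated transpose_mult_rotated[OF Q] curvature_strain_def)
  qed
qed

text \<open>Besides the integrand, the domain of finiteness has to be invariant. This follows by applying the
  isometry invariance of the Sobolev spaces to \<open>Q\<close> and to its inverse.\<close>

lemma shell_energy_rotated:
  assumes \<omega>: "open \<omega>" and Q: "Q \<in> SO3"
    and n: "\<And>x. x \<in> \<omega> \<Longrightarrow> n x = Q *v m x" and S: "\<And>x. x \<in> \<omega> \<Longrightarrow> S x = Q ** R x"
  shows "shell_energy h \<mu> \<mu>c lam \<kappa> Lc q \<omega> n S = shell_energy h \<mu> \<mu>c lam \<kappa> Lc q \<omega> m R"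
proof -
  note Q' = SO3_transpose[OF Q]
  have m: "m x = transpose Q *v n x" and R: "R x = transpose Q ** S x" if "x \<in> \<omega>" for x
    using that by (simp_all add: n S SO3_cancel_left[OF Q] del: transpose_matrix_vector)
  have m_iff: "n \<in> Sobolev_1 2 \<omega> \<longleftrightarrow> m \<in> Sobolev_1 2 \<omega>"
    using Sobolev_1_isometry[where u = m and v = n,
        OF \<omega> matrix_vector_mul_bounded_linear norm_rotated_vector[OF Q] _ n]
      Sobolev_1_isometry[where u = n and v = m,
        OF \<omega> matrix_vector_mul_bounded_linear norm_rotated_vector[OF Q'] _ m]
    by blast
  have "S x \<in> SO3 \<longleftrightarrow> R x \<in> SO3" if "x \<in> \<omega>" for x
    using SO3_mult[OF Q] SO3_mult[OF Q'] S R that by metis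
  then have "(AE x in lebesgue_on \<omega>. S x \<in> SO3) \<longleftrightarrow> (AE x in lebesgue_on \<omega>. R x \<in> SO3)"
    by (intro AE_cong) simp
  then have R_iff: "S \<in> Sobolev_1_SO3 q \<omega> \<longleftrightarrow> R \<in> Sobolev_1_SO3 q \<omega>"
    using Sobolev_1_isometry[where u = R and v = S,
        OF \<omega> bounded_linear_matrix_mult norm_rotated_matrix[OF Q] _ S]
      Sobolev_1_isometry[where u = S and v = R,
        OF \<omega> bounded_linear_matrix_mult norm_rotated_matrix[OF Q'] _ R]
    by (auto simp: Sobolev_1_SO3_def)
  show ?thesis
  proof (cases "m \<in> Sobolev_1 2 \<omega> \<and> R \<in> Sobolev_1_SO3 q \<omega>")
    case True
    then have mS: "m \<in> Sobolev_1 2 \<omega>" and RS: "R \<in> Sobolev_1 q \<omega>"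
      by (auto simp: Sobolev_1_SO3_def)
    have wm: "AE x in lebesgue_on \<omega>. weak_partial \<omega> j n x = Q *v weak_partial \<omega> j m x" for j
    proof -
      obtain g where "is_weak_partial \<omega> j m g"
        using mS by (auto simp: Sobolev_1_def)
      then show ?thesis
        by (rule weak_partial_bounded_linear[OF \<omega> matrix_vector_mul_bounded_linear _ n])
    qed
    have wK: "AE x in lebesgue_on \<omega>. curvature_strain \<omega> S i x = curvature_strain \<omega> R i x" for i
      by (rule curvature_strain_rotated[OF \<omega> Q RS]) (rule S)
    have space: "AE x in lebesgue_on \<omega>. x \<in> \<omega>"
      by (rule AE_I2) simp
    from wm[of 1] wm[of 2] wK[of 1] wK[of 2] wK[of 3] space
    have "AE x in lebesgue_on \<omega>.
        (let K = (\<lambda>i. curvature_strain \<omega> S i x) in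
          ennreal h * W_mp \<mu> \<mu>c lam \<kappa> (weak_partial \<omega> 1 n x) (weak_partial \<omega> 2 n x) (S x)
          + ennreal (h * W_curv \<mu> Lc q (K 1) (K 2) (K 3))
          + ennreal (h^3 / 12 * W_bend \<mu> \<mu>c lam (K 3))) =
        (let K = (\<lambda>i. curvature_strain \<omega> R i x) in
          ennreal h * W_mp \<mu> \<mu>c lam \<kappa> (weak_partial \<omega> 1 m x) (weak_partial \<omega> 2 m x) (R x)
          + ennreal (h * W_curv \<mu> Lc q (K 1) (K 2) (K 3))
          + ennreal (h^3 / 12 * W_bend \<mu> \<mu>c lam (K 3)))"
      by eventually_elim (simp add: S W_mp_rotated[OF Q])
    from nn_integral_cong_AE[OF this] show ?thesis
      unfolding shell_energy_def using m_iff R_iff by simp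
  next
    case False
    then show ?thesis
      unfolding shell_energy_def using m_iff R_iff by auto
  qed
qed

section \<open>Reference coordinates on an element\<close>

lemma cross2_independent:
  assumes "cross2 u v \<noteq> 0" and "s *\<^sub>R u + t *\<^sub>R v = 0"
  shows "s = 0 \<and> t = 0"
proof -
  have eqs: "s * u$1 + t * v$1 = 0" "s * u$2 + t * v$2 = 0"
    using assms(2) by (simp_all add: vec_eq_iff forall_2)
  have "s * cross2 u v = (s * u$1 + t * v$1) * v$2 - (s * u$2 + t * v$2) * v$1"
    "t * cross2 u v = (s * u$2 + t * v$2) * u$1 - (s * u$1 + t * v$1) * u$2"
    by (simp_all add: cross2_def algebra_simps)
  then have "s * cross2 u v = 0" "t * cross2 u v = 0"
    by (simp_all only: eqs)
  then show ?thesis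
    using assms(1) by simp
qed

text \<open>The Jacobian determinant of the bilinear map of a quadrilateral is an affine function of $(s,t)$,
  since the quadratic terms cancel. Its values at the corners of the unit square are the four cross
  products of the hypothesis, and it is their bilinear interpolation.\<close>

lemma bilinear_jacobian_pos:
  assumes corners: "0 < \<sigma> * cross2 (b - a) (d - a)" "0 < \<sigma> * cross2 (c - b) (a - b)"
    "0 < \<sigma> * cross2 (d - c) (b - c)" "0 < \<sigma> * cross2 (a - d) (c - d)"
    and st: "0 \<le> s" "s \<le> 1" "0 \<le> t" "t \<le> 1"
  shows "0 < \<sigma> * cross2 ((b - a) + t *\<^sub>R (a - b + c - d)) ((d - a) + s *\<^sub>R (a - b + c - d))"
proof -
  let ?J00 = "\<sigma> * cross2 (b - a) (d - a)" and ?J10 = "\<sigma> * cross2 (c - b) (a - b)"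
    and ?J11 = "\<sigma> * cross2 (d - c) (b - c)" and ?J01 = "\<sigma> * cross2 (a - d) (c - d)"
  define M where "M = min (min ?J00 ?J10) (min ?J11 ?J01)"
  have M: "0 < M" "M \<le> ?J00" "M \<le> ?J10" "M \<le> ?J11" "M \<le> ?J01"
    using corners by (auto simp: M_def)
  have "\<sigma> * cross2 ((b - a) + t *\<^sub>R (a - b + c - d)) ((d - a) + s *\<^sub>R (a - b + c - d)) =
      (1 - s) * (1 - t) * ?J00 + s * (1 - t) * ?J10 + s * t * ?J11 + (1 - s) * t * ?J01"
    by (simp add: cross2_def algebra_simps)
  also have "\<dots> \<ge> (1 - s) * (1 - t) * M + s * (1 - t) * M + s * t * M + (1 - s) * t * M"
    using M st by (intro add_mono mult_left_mono mult_nonneg_nonneg) auto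
  also have "(1 - s) * (1 - t) * M + s * (1 - t) * M + s * t * M + (1 - s) * t * M = M"
    by (simp add: algebra_simps)
  finally show ?thesis using M(1) by linarith
qed

text \<open>For triangles the map is affine. For quadrilaterals the difference of two values is exactly the
  Jacobian at the midpoint of the two arguments, applied to their difference, because the mixed term
  satisfies $st - s't' = (s - s')\,\frac{t + t'}{2} + (t - t')\,\frac{s + s'}{2}$. The midpoint lies
  in the unit square, where the Jacobian is invertible.\<close>

lemma inj_on_from_ref:
  assumes "nondegenerate T"
  shows "inj_on (from_ref T) (ref_element T)"
proof (cases T)
  case (Triangle a b c)
  show ?thesis
  proof (rule inj_onI)
    fix \<xi> \<eta> assume "from_ref T \<xi> = from_ref T \<eta>"
    then have "(\<xi>$1 - \<eta>$1) *\<^sub>R (b - a) + (\<xi>$2 - \<eta>$2) *\<^sub>R (c - a) = 0"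
      by (simp add: Triangle algebra_simps)
    then have "\<xi>$1 - \<eta>$1 = 0 \<and> \<xi>$2 - \<eta>$2 = 0"
      using assms Triangle by (intro cross2_independent) auto
    then show "\<xi> = \<eta>" by (simp add: vec_eq_iff forall_2)
  qed
next
  case (Quadrilateral a b c d)
  then obtain \<sigma> where \<sigma>: "0 < \<sigma> * cross2 (b - a) (d - a)" "0 < \<sigma> * cross2 (c - b) (a - b)"
    "0 < \<sigma> * cross2 (d - c) (b - c)" "0 < \<sigma> * cross2 (a - d) (c - d)"
    using assms[unfolded Quadrilateral nondegenerate.simps] by blast
  show ?thesis
  proof (rule inj_onI)
    fix \<xi> \<eta> assume mem: "\<xi> \<in> ref_element T" "\<eta> \<in> ref_element T"
      and eq: "from_ref T \<xi> = from_ref T \<eta>"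
    let ?w = "a - b + c - d"
    let ?s = "(\<xi>$1 + \<eta>$1) / 2" and ?t = "(\<xi>$2 + \<eta>$2) / 2"
    have "(\<xi>$1 - \<eta>$1) *\<^sub>R ((b - a) + ?t *\<^sub>R ?w) + (\<xi>$2 - \<eta>$2) *\<^sub>R ((d - a) + ?s *\<^sub>R ?w)
        = from_ref T \<xi> - from_ref T \<eta>"
      by (simp add: Quadrilateral vec_eq_iff field_simps)
    moreover have "0 < \<sigma> * cross2 ((b - a) + ?t *\<^sub>R ?w) ((d - a) + ?s *\<^sub>R ?w)"
      using mem Quadrilateral by (intro bilinear_jacobian_pos \<sigma>) auto
    ultimately have "\<xi>$1 - \<eta>$1 = 0 \<and> \<xi>$2 - \<eta>$2 = 0"
      using eq by (intro cross2_independent) auto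
    then show "\<xi> = \<eta>" by (simp add: vec_eq_iff forall_2)
  qed
qed

lemma to_ref_from_ref:
  "nondegenerate T \<Longrightarrow> \<xi> \<in> ref_element T \<Longrightarrow> to_ref T (from_ref T \<xi>) = \<xi>"
  unfolding to_ref_def by (intro the_inv_into_f_f inj_on_from_ref)

lemma compact_ref_element: "compact (ref_element T)"
proof -
  have "closed (ref_element T)"
    by (cases T) (auto intro!: closed_Collect_conj closed_Collect_le continuous_intros)
  moreover have "ref_element T \<subseteq> cbox 0 1"
    by (cases T) (auto simp: mem_box_cart forall_2)
  ultimately show ?thesis
    by (meson bounded_cbox bounded_subset compact_eq_bounded_closed)
qed

lemma continuous_on_from_ref: "continuous_on A (from_ref T)"
proof (cases T)
  case (Triangle a b c)
  have "from_ref T = (\<lambda>\<xi>. (1 - \<xi>$1 - \<xi>$2) *\<^sub>R a + \<xi>$1 *\<^sub>R b + \<xi>$2 *\<^sub>R c)"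
    by (auto simp: Triangle)
  then show ?thesis by (auto intro!: continuous_intros)
next
  case (Quadrilateral a b c d)
  have "from_ref T = (\<lambda>\<xi>. ((1 - \<xi>$1) * (1 - \<xi>$2)) *\<^sub>R a + (\<xi>$1 * (1 - \<xi>$2)) *\<^sub>R b
     + (\<xi>$1 * \<xi>$2) *\<^sub>R c + ((1 - \<xi>$1) * \<xi>$2) *\<^sub>R d)"
    by (auto simp: Quadrilateral)
  then show ?thesis by (auto intro!: continuous_intros)
qed

lemma compact_cell: "compact (cell T)"
  unfolding cell_def by (intro compact_continuous_image continuous_on_from_ref compact_ref_element)

lemma continuous_on_to_ref: "nondegenerate T \<Longrightarrow> continuous_on (cell T) (to_ref T)"
  unfolding cell_def to_ref_def[abs_def]
  by (intro continuous_on_inv_into continuous_on_from_ref compact_ref_element inj_on_from_ref)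

lemma finite_ref_indices: "finite (ref_indices p T)"
proof -
  have "ref_indices p T \<subseteq> {..p} \<times> {..p}" by (cases T) auto
  then show ?thesis by (rule finite_subset) simp
qed

lemma ref_node_in_ref_element:
  assumes "p > 0" and "a \<in> ref_indices p T"
  shows "ref_node p a \<in> ref_element T"
proof -
  obtain i j where a: "a = (i, j)" by fastforce
  have "real i / real p + real j / real p = real (i + j) / real p"
    by (simp add: add_divide_distrib)
  then show ?thesis
    using assms a by (cases T) (auto simp: divide_le_eq_1)
qed

lemma element_node_in_cell: "p > 0 \<Longrightarrow> a \<in> ref_indices p T \<Longrightarrow> element_node p T a \<in> cell T"
  by (simp add: element_node_def cell_def ref_node_in_ref_element)

lemma continuous_on_shape_fn: "continuous_on A (shape_fn p T a)"
proof -
  obtain i j where a: "a = (i, j)" by fastforce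
  have lower: "continuous_on A (\<lambda>\<xi>. lower_factor p k (f \<xi>))"
    and lagrange: "continuous_on A (\<lambda>\<xi>. lagrange_1d p k (f \<xi>))"
    if "continuous_on A f" for k and f :: "real^2 \<Rightarrow> real"
    using that unfolding lower_factor_def lagrange_1d_def divide_inverse
    by (auto intro!: continuous_intros)
  show ?thesis
  proof (cases T)
    case (Triangle u v w)
    have "shape_fn p T a = (\<lambda>\<xi>. lower_factor p i (\<xi>$1) * lower_factor p j (\<xi>$2)
        * lower_factor p (p - i - j) (1 - \<xi>$1 - \<xi>$2))"
      by (auto simp: Triangle a)
    then show ?thesis by (auto intro!: continuous_intros lower)
  next
    case (Quadrilateral u v w z)
    have "shape_fn p T a = (\<lambda>\<xi>. lagrange_1d p i (\<xi>$1) * lagrange_1d p j (\<xi>$2))"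
      by (auto simp: Quadrilateral a)
    then show ?thesis by (auto intro!: continuous_intros lagrange)
  qed
qed

section \<open>Lagrange interpolation on a conforming grid\<close>

text \<open>The Lagrange interpolant of nodal values that are given globally, as a function \<open>g\<close> of the
  position; this form makes the interpolants on neighbouring elements comparable.\<close>

definition local_interpolant :: "nat \<Rightarrow> element \<Rightarrow> (real^2 \<Rightarrow> real^3) \<Rightarrow> real^2 \<Rightarrow> real^3" where
  "local_interpolant p T g x =
     (\<Sum>a \<in> ref_indices p T. shape_fn p T a (to_ref T x) *\<^sub>R g (element_node p T a))"

lemma local_interpolant_cong:
  "(\<And>a. a \<in> ref_indices p T \<Longrightarrow> g (element_node p T a) = g' (element_node p T a)) \<Longrightarrow>
    local_interpolant p T g x = local_interpolant p T g' x"
  by (simp add: local_interpolant_def)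

lemma shape_fn_combination_node:
  fixes c :: "nat \<times> nat \<Rightarrow> real^3"
  assumes "p > 0" and "nondegenerate T" and "b \<in> ref_indices p T"
  shows "(\<Sum>a \<in> ref_indices p T. shape_fn p T a (to_ref T (element_node p T b)) *\<^sub>R c a) = c b"
proof -
  have "(\<Sum>a \<in> ref_indices p T. shape_fn p T a (to_ref T (element_node p T b)) *\<^sub>R c a) =
      (\<Sum>a \<in> ref_indices p T. if a = b then c a else 0)"
    using assms
    by (intro sum.cong) (auto simp: element_node_def to_ref_from_ref ref_node_in_ref_element shape_fn_node)
  also have "\<dots> = c b"
    using assms(3) by (simp add: finite_ref_indices)
  finally show ?thesis .
qed

lemma continuous_on_local_interpolant:
  "nondegenerate T \<Longrightarrow> continuous_on (cell T) (local_interpolant p T g)"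
  unfolding local_interpolant_def[abs_def]
  by (intro continuous_intros continuous_on_compose2[OF continuous_on_shape_fn continuous_on_to_ref]) auto

lemma degree_prod_linear_le:
  "(\<And>l. l \<in> S \<Longrightarrow> degree (f l) \<le> 1) \<Longrightarrow> finite S \<Longrightarrow> degree (prod f S) \<le> card S"
  using degree_prod_sum_le[of S f] sum_bounded_above[of S "degree \<circ> f" 1] by simp

lemma lower_factor_affine:
  obtains P where "degree P \<le> i" and "\<And>t. lower_factor p i (\<alpha> + t * \<beta>) = poly P t"
proof
  let ?P = "\<Prod>l<i. [:(real p * \<alpha> - real l) / (real i - real l), real p * \<beta> / (real i - real l):]"
  show "degree ?P \<le> i"
    using degree_prod_linear_le[of "{..<i}" "\<lambda>l. [:(real p * \<alpha> - real l) / (real i - real l), real p * \<beta> / (real i - real l):]"]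
    by simp
  show "lower_factor p i (\<alpha> + t * \<beta>) = poly ?P t" for t
    unfolding lower_factor_def poly_prod
    by (intro prod.cong refl) (simp add: algebra_simps add_divide_distrib diff_divide_distrib)
qed

lemma lagrange_1d_affine:
  assumes "i \<le> p"
  obtains P where "degree P \<le> p" and "\<And>t. lagrange_1d p i (\<alpha> + t * \<beta>) = poly P t"
proof
  let ?P = "\<Prod>l\<in>{..p} - {i}. [:(real p * \<alpha> - real l) / (real i - real l), real p * \<beta> / (real i - real l):]"
  show "degree ?P \<le> p"
    using degree_prod_linear_le[of "{..p} - {i}" "\<lambda>l. [:(real p * \<alpha> - real l) / (real i - real l), real p * \<beta> / (real i - real l):]"] assms
    by simp
  show "lagrange_1d p i (\<alpha> + t * \<beta>) = poly ?P t" for t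
    unfolding lagrange_1d_def poly_prod
    by (intro prod.cong refl) (simp add: algebra_simps add_divide_distrib diff_divide_distrib)
qed

text \<open>On a quadrilateral, shape functions have degree \<open>p\<close> in each variable, hence possibly $2p$ along a
  slanted line; along the axis-parallel edges of the reference square, the degree is at most \<open>p\<close>.\<close>

fun edge_direction :: "element \<Rightarrow> real^2 \<Rightarrow> bool" where
  "edge_direction (Triangle a b c) \<delta> \<longleftrightarrow> True"
| "edge_direction (Quadrilateral a b c d) \<delta> \<longleftrightarrow> \<delta>$1 = 0 \<or> \<delta>$2 = 0"

text \<open>On a triangle the three factors have degrees at most $i$, $j$ and $p - i - j$ along any line, with sum
  \<open>p\<close>. On a quadrilateral one of the two factors is constant in the given direction.\<close>

lemma shape_fn_along_edge:
  assumes a: "a \<in> ref_indices p T" and dir: "edge_direction T \<delta>"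
  obtains P where "degree P \<le> p" and "\<And>t. shape_fn p T a (\<xi> + t *\<^sub>R \<delta>) = poly P t"
proof -
  obtain i j where ij: "a = (i, j)" by fastforce
  show thesis
  proof (cases T)
    case (Triangle u v w)
    then have le: "i + j \<le> p" using a ij by simp
    obtain P1 where P1: "degree P1 \<le> i" "\<And>t. lower_factor p i (\<xi>$1 + t * \<delta>$1) = poly P1 t"
      using lower_factor_affine[of i p "\<xi>$1" "\<delta>$1"] by blast
    obtain P2 where P2: "degree P2 \<le> j" "\<And>t. lower_factor p j (\<xi>$2 + t * \<delta>$2) = poly P2 t"
      using lower_factor_affine[of j p "\<xi>$2" "\<delta>$2"] by blast
    obtain P3 where P3: "degree P3 \<le> p - i - j"
      "\<And>t. lower_factor p (p - i - j) ((1 - \<xi>$1 - \<xi>$2) + t * (- \<delta>$1 - \<delta>$2)) = poly P3 t"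
      using lower_factor_affine[of "p - i - j" p "1 - \<xi>$1 - \<xi>$2" "- \<delta>$1 - \<delta>$2"] by blast
    have arg: "1 - (\<xi>$1 + t * \<delta>$1) - (\<xi>$2 + t * \<delta>$2) = (1 - \<xi>$1 - \<xi>$2) + t * (- \<delta>$1 - \<delta>$2)" for t
      by (simp add: algebra_simps)
    show thesis
    proof (rule that)
      have "degree (P1 * P2 * P3) \<le> i + j + (p - i - j)"
        using P1(1) P2(1) P3(1) degree_mult_le[of "P1 * P2" P3] degree_mult_le[of P1 P2] by linarith
      then show "degree (P1 * P2 * P3) \<le> p" using le by simp
      show "shape_fn p T a (\<xi> + t *\<^sub>R \<delta>) = poly (P1 * P2 * P3) t" for t
        by (simp only: Triangle ij shape_fn.simps vector_add_component vector_scaleR_component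
            real_scaleR_def arg P1(2) P2(2) P3(2) poly_mult)
    qed
  next
    case (Quadrilateral u v w z)
    then have le: "i \<le> p" "j \<le> p" using a ij by simp_all
    obtain P1 where P1: "degree P1 \<le> p" "\<And>t. lagrange_1d p i (\<xi>$1 + t * \<delta>$1) = poly P1 t"
      using lagrange_1d_affine[of i p "\<xi>$1" "\<delta>$1"] le by blast
    obtain P2 where P2: "degree P2 \<le> p" "\<And>t. lagrange_1d p j (\<xi>$2 + t * \<delta>$2) = poly P2 t"
      using lagrange_1d_affine[of j p "\<xi>$2" "\<delta>$2"] le by blast
    have "\<delta>$1 = 0 \<or> \<delta>$2 = 0" using dir Quadrilateral by simp
    then show thesis
    proof
      assume "\<delta>$1 = 0"
      then show thesis
        using P2 by (intro that[of "smult (lagrange_1d p i (\<xi>$1)) P2"])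
          (simp_all add: Quadrilateral ij degree_smult_le[THEN order_trans])
    next
      assume "\<delta>$2 = 0"
      then show thesis
        using P1 by (intro that[of "smult (lagrange_1d p j (\<xi>$2)) P1"])
          (simp_all add: Quadrilateral ij degree_smult_le[THEN order_trans])
    qed
  qed
qed

text \<open>The reference edge from \<open>\<xi>\<close> to \<open>\<eta>\<close> is mapped to the edge from \<open>A\<close> to \<open>B\<close> with constant speed,
  and the Lagrange nodes on it include the $p+1$ equispaced points. These are all the facts
  about the shape and orientation of an edge that the comparison of traces uses.\<close>

definition edge_chart :: "nat \<Rightarrow> element \<Rightarrow> real^2 \<Rightarrow> real^2 \<Rightarrow> real^2 \<Rightarrow> real^2 \<Rightarrow> bool" where
  "edge_chart p T A B \<xi> \<eta> \<longleftrightarrow>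
     edge_direction T (\<eta> - \<xi>) \<and>
     (\<forall>t. from_ref T (\<xi> + t *\<^sub>R (\<eta> - \<xi>)) = A + t *\<^sub>R (B - A)) \<and>
     (\<forall>t\<in>{0..1}. \<xi> + t *\<^sub>R (\<eta> - \<xi>) \<in> ref_element T) \<and>
     (\<forall>k\<le>p. \<exists>a\<in>ref_indices p T. ref_node p a = \<xi> + (real k / real p) *\<^sub>R (\<eta> - \<xi>))"

text \<open>Neighbouring elements may run through a common edge in opposite directions.\<close>

lemma edge_chart_flip:
  assumes "edge_chart p T A B \<xi> \<eta>" and "p > 0"
  shows "edge_chart p T B A \<eta> \<xi>"
proof -
  have flip: "B + t *\<^sub>R (A - B) = A + (1 - t) *\<^sub>R (B - A)"
    "\<eta> + t *\<^sub>R (\<xi> - \<eta>) = \<xi> + (1 - t) *\<^sub>R (\<eta> - \<xi>)" for t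
    by (simp_all add: algebra_simps)
  have "edge_direction T (\<xi> - \<eta>)"
    using assms by (cases T) (auto simp: edge_chart_def)
  moreover have "\<exists>a\<in>ref_indices p T. ref_node p a = \<xi> + (1 - real k / real p) *\<^sub>R (\<eta> - \<xi>)"
    if "k \<le> p" for k
  proof -
    have "1 - real k / real p = real (p - k) / real p"
      using that assms(2) by (simp add: of_nat_diff diff_divide_distrib)
    then show ?thesis
      using assms(1) unfolding edge_chart_def by (metis diff_le_self)
  qed
  moreover have "from_ref T (\<xi> + (1 - t) *\<^sub>R (\<eta> - \<xi>)) = A + (1 - t) *\<^sub>R (B - A)" for t
    using assms(1) unfolding edge_chart_def by blast
  moreover have "\<xi> + (1 - t) *\<^sub>R (\<eta> - \<xi>) \<in> ref_element T" if "t \<in> {0..1}" for t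
    using assms(1) that unfolding edge_chart_def by simp
  ultimately show ?thesis
    unfolding edge_chart_def flip by blast
qed

lemma edge_chart_sides:
  assumes "p > 0"
  shows "edge_chart p (Triangle a b c) a b (vector [0, 0]) (vector [1, 0])"
    and "edge_chart p (Triangle a b c) b c (vector [1, 0]) (vector [0, 1])"
    and "edge_chart p (Triangle a b c) a c (vector [0, 0]) (vector [0, 1])"
    and "edge_chart p (Quadrilateral a b c d) a b (vector [0, 0]) (vector [1, 0])"
    and "edge_chart p (Quadrilateral a b c d) b c (vector [1, 0]) (vector [1, 1])"
    and "edge_chart p (Quadrilateral a b c d) d c (vector [0, 1]) (vector [1, 1])"
    and "edge_chart p (Quadrilateral a b c d) a d (vector [0, 0]) (vector [0, 1])"
proof -
  have chartI: "edge_chart p T A B \<xi> \<eta>"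
    if "edge_direction T (\<eta> - \<xi>)" "\<And>t. from_ref T (\<xi> + t *\<^sub>R (\<eta> - \<xi>)) = A + t *\<^sub>R (B - A)"
      "\<And>t. 0 \<le> t \<Longrightarrow> t \<le> 1 \<Longrightarrow> \<xi> + t *\<^sub>R (\<eta> - \<xi>) \<in> ref_element T"
      "\<And>k. k \<le> p \<Longrightarrow> f k \<in> ref_indices p T"
      "\<And>k. k \<le> p \<Longrightarrow> ref_node p (f k) = \<xi> + (real k / real p) *\<^sub>R (\<eta> - \<xi>)"
    for T A B \<xi> \<eta> and f :: "nat \<Rightarrow> nat \<times> nat"
    using that unfolding edge_chart_def by (auto intro!: bexI[of _ "f _"])
  note simps = vec_eq_iff forall_2 algebra_simps
  show "edge_chart p (Triangle a b c) a b (vector [0, 0]) (vector [1, 0])"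
    by (rule chartI[where f = "\<lambda>k. (k, 0)"]) (use assms in \<open>auto simp: simps\<close>)
  show "edge_chart p (Triangle a b c) b c (vector [1, 0]) (vector [0, 1])"
    by (rule chartI[where f = "\<lambda>k. (p - k, k)"])
      (use assms in \<open>auto simp: simps of_nat_diff diff_divide_distrib\<close>)
  show "edge_chart p (Triangle a b c) a c (vector [0, 0]) (vector [0, 1])"
    by (rule chartI[where f = "\<lambda>k. (0, k)"]) (use assms in \<open>auto simp: simps\<close>)
  show "edge_chart p (Quadrilateral a b c d) a b (vector [0, 0]) (vector [1, 0])"
    by (rule chartI[where f = "\<lambda>k. (k, 0)"]) (use assms in \<open>auto simp: simps\<close>)
  show "edge_chart p (Quadrilateral a b c d) b c (vector [1, 0]) (vector [1, 1])"
    by (rule chartI[where f = "\<lambda>k. (p, k)"]) (use assms in \<open>auto simp: simps\<close>)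
  show "edge_chart p (Quadrilateral a b c d) d c (vector [0, 1]) (vector [1, 1])"
    by (rule chartI[where f = "\<lambda>k. (k, p)"]) (use assms in \<open>auto simp: simps\<close>)
  show "edge_chart p (Quadrilateral a b c d) a d (vector [0, 0]) (vector [0, 1])"
    by (rule chartI[where f = "\<lambda>k. (0, k)"]) (use assms in \<open>auto simp: simps\<close>)
qed

lemma edge_chart_exists:
  assumes p: "p > 0" and "{A, B} \<in> edges T"
  shows "\<exists>\<xi> \<eta>. edge_chart p T A B \<xi> \<eta>"
proof -
  have "\<exists>C D \<xi> \<eta>. {A, B} = {C, D} \<and> edge_chart p T C D \<xi> \<eta>"
  proof (cases T)
    case (Triangle a b c)
    have "{A, B} = {a, b} \<or> {A, B} = {b, c} \<or> {A, B} = {a, c}"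
      using assms(2) unfolding Triangle edges.simps insert_iff empty_iff by (metis insert_commute)
    then show ?thesis
      using edge_chart_sides(1-3)[OF p, of a b c] unfolding Triangle by metis
  next
    case (Quadrilateral a b c d)
    have "{A, B} = {a, b} \<or> {A, B} = {b, c} \<or> {A, B} = {d, c} \<or> {A, B} = {a, d}"
      using assms(2) unfolding Quadrilateral edges.simps insert_iff empty_iff by (metis insert_commute)
    then show ?thesis
      using edge_chart_sides(4-7)[OF p, of a b c d] unfolding Quadrilateral by metis
  qed
  then obtain C D \<xi> \<eta> where "{A, B} = {C, D}" "edge_chart p T C D \<xi> \<eta>" by blast
  then show ?thesis
    using edge_chart_flip[OF _ p] by (fastforce simp: doubleton_eq_iff)
qed

text \<open>The trace of the local interpolant on an edge is a polynomial of degree at most \<open>p\<close> in the affine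
  parameter of the edge, whose values at $0, 1/p, \ldots, 1$ depend on the edge and on \<open>g\<close> only.\<close>

lemma edge_trace:
  assumes p: "p > 0" and T: "nondegenerate T" and "{A, B} \<in> edges T"
  obtains P where "degree P \<le> p"
    and "\<And>t. 0 \<le> t \<Longrightarrow> t \<le> 1 \<Longrightarrow> local_interpolant p T g (A + t *\<^sub>R (B - A)) $ i = poly P t"
    and "\<And>k. k \<le> p \<Longrightarrow> poly P (real k / real p) = g (A + (real k / real p) *\<^sub>R (B - A)) $ i"
proof -
  obtain \<xi> \<eta> where chart: "edge_direction T (\<eta> - \<xi>)"
    "\<And>t. from_ref T (\<xi> + t *\<^sub>R (\<eta> - \<xi>)) = A + t *\<^sub>R (B - A)"
    "\<And>t. 0 \<le> t \<Longrightarrow> t \<le> 1 \<Longrightarrow> \<xi> + t *\<^sub>R (\<eta> - \<xi>) \<in> ref_element T"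
    "\<And>k. k \<le> p \<Longrightarrow> \<exists>a\<in>ref_indices p T. ref_node p a = \<xi> + (real k / real p) *\<^sub>R (\<eta> - \<xi>)"
    using edge_chart_exists[OF p assms(3)] unfolding edge_chart_def by auto
  have "\<forall>a\<in>ref_indices p T. \<exists>P. degree P \<le> p \<and> (\<forall>t. shape_fn p T a (\<xi> + t *\<^sub>R (\<eta> - \<xi>)) = poly P t)"
    using shape_fn_along_edge[OF _ chart(1)] by metis
  then obtain P where P: "\<And>a. a \<in> ref_indices p T \<Longrightarrow> degree (P a) \<le> p"
    "\<And>a t. a \<in> ref_indices p T \<Longrightarrow> shape_fn p T a (\<xi> + t *\<^sub>R (\<eta> - \<xi>)) = poly (P a) t"
    by metis
  let ?P = "\<Sum>a\<in>ref_indices p T. smult (g (element_node p T a) $ i) (P a)"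
  have val: "local_interpolant p T g (A + t *\<^sub>R (B - A)) $ i = poly ?P t" if "0 \<le> t" "t \<le> 1" for t
  proof -
    have "to_ref T (A + t *\<^sub>R (B - A)) = \<xi> + t *\<^sub>R (\<eta> - \<xi>)"
      using to_ref_from_ref[OF T chart(3)[OF that]] by (simp only: chart(2))
    then show ?thesis
      by (simp add: local_interpolant_def P(2) poly_sum mult.commute)
  qed
  show thesis
  proof (rule that[OF _ val])
    show "degree ?P \<le> p"
      using P(1) by (intro degree_sum_le finite_ref_indices order_trans[OF degree_smult_le])
    fix k assume k: "k \<le> p"
    obtain a where a: "a \<in> ref_indices p T" "ref_node p a = \<xi> + (real k / real p) *\<^sub>R (\<eta> - \<xi>)"
      using chart(4)[OF k] by blast
    then have node: "element_node p T a = A + (real k / real p) *\<^sub>R (B - A)"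
      by (simp add: element_node_def chart(2))
    have "local_interpolant p T g (element_node p T a) = g (element_node p T a)"
      unfolding local_interpolant_def by (rule shape_fn_combination_node[OF p T a(1)])
    then show "poly ?P (real k / real p) = g (A + (real k / real p) *\<^sub>R (B - A)) $ i"
      using val[of "real k / real p"] k p by (simp add: node)
  qed auto
qed

text \<open>The two traces are polynomials of degree at most \<open>p\<close> that agree at the $p+1$ nodes of the edge.
  Both elements use the parametrization from \<open>A\<close> to \<open>B\<close>, whatever their own orientation.\<close>

lemma local_interpolants_agree_on_edge:
  assumes p: "p > 0" and T: "nondegenerate T" "nondegenerate T'"
    and e: "e \<in> edges T" "e \<in> edges T'" and x: "x \<in> convex hull e"
  shows "local_interpolant p T g x = local_interpolant p T' g x"
proof -
  obtain A B where AB: "e = {A, B}"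
    using e(1) by (cases T) auto
  then obtain t where t: "0 \<le> t" "t \<le> 1" "x = A + t *\<^sub>R (B - A)"
    using x by (auto simp: convex_hull_2_alt)
  have "local_interpolant p T g x $ i = local_interpolant p T' g x $ i" for i
  proof -
    obtain P where P: "degree P \<le> p"
      "\<And>t. 0 \<le> t \<Longrightarrow> t \<le> 1 \<Longrightarrow> local_interpolant p T g (A + t *\<^sub>R (B - A)) $ i = poly P t"
      "\<And>k. k \<le> p \<Longrightarrow> poly P (real k / real p) = g (A + (real k / real p) *\<^sub>R (B - A)) $ i"
      using edge_trace[OF p T(1) e(1)[unfolded AB]] by blast
    obtain P' where P': "degree P' \<le> p"
      "\<And>t. 0 \<le> t \<Longrightarrow> t \<le> 1 \<Longrightarrow> local_interpolant p T' g (A + t *\<^sub>R (B - A)) $ i = poly P' t"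
      "\<And>k. k \<le> p \<Longrightarrow> poly P' (real k / real p) = g (A + (real k / real p) *\<^sub>R (B - A)) $ i"
      using edge_trace[OF p T(2) e(2)[unfolded AB]] by blast
    have "inj_on (\<lambda>k. real k / real p) {..p}"
      using p by (auto simp: inj_on_def)
    then have card: "card ((\<lambda>k. real k / real p) ` {..p}) = Suc p"
      by (simp add: card_image)
    have "P = P'"
      by (rule poly_eqI_degree[where A = "(\<lambda>k. real k / real p) ` {..p}"])
        (use P P' card in auto)
    then show ?thesis
      using P(2) P'(2) t by simp
  qed
  then show ?thesis by (simp add: vec_eq_iff)
qed

text \<open>A vertex is the starting point of an edge, and thus the node with parameter $0$ on that edge.\<close>

lemma vertex_is_node:
  assumes "p > 0" and "v \<in> vertices T"
  shows "\<exists>a\<in>ref_indices p T. element_node p T a = v"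
proof -
  have "\<exists>B. {v, B} \<in> edges T"
  proof (cases T)
    case (Triangle a b c)
    then have "v = a \<or> v = b \<or> v = c" using assms(2) by simp
    then show ?thesis unfolding Triangle edges.simps by (metis insertI1 insertI2)
  next
    case (Quadrilateral a b c d)
    then have "v = a \<or> v = b \<or> v = c \<or> v = d" using assms(2) by simp
    then show ?thesis unfolding Quadrilateral edges.simps by (metis insertI1 insertI2)
  qed
  then obtain B \<xi> \<eta> where chart: "edge_chart p T v B \<xi> \<eta>"
    using edge_chart_exists[OF assms(1)] by blast
  then have "\<exists>a\<in>ref_indices p T. ref_node p a = \<xi> + (real 0 / real p) *\<^sub>R (\<eta> - \<xi>)"
    unfolding edge_chart_def by blast
  moreover have "from_ref T (\<xi> + 0 *\<^sub>R (\<eta> - \<xi>)) = v + 0 *\<^sub>R (B - v)"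
    using chart unfolding edge_chart_def by blast
  ultimately show ?thesis by (auto simp: element_node_def)
qed

lemma local_interpolants_agree:
  assumes p: "p > 0" and G: "conforming_grid \<omega> G" and T: "T \<in> G" "T' \<in> G"
    and x: "x \<in> cell T" "x \<in> cell T'"
  shows "local_interpolant p T g x = local_interpolant p T' g x"
proof (cases "T = T'")
  case False
  have nd: "nondegenerate T" "nondegenerate T'"
    using G T by (auto simp: conforming_grid_def)
  have "cell T \<inter> cell T' = {} \<or> (\<exists>v \<in> vertices T \<inter> vertices T'. cell T \<inter> cell T' = {v}) \<or>
      (\<exists>e \<in> edges T \<inter> edges T'. cell T \<inter> cell T' = convex hull e)"
    using G T False unfolding conforming_grid_def by blast
  then consider "x \<in> vertices T" "x \<in> vertices T'"
    | e where "e \<in> edges T" "e \<in> edges T'" "x \<in> convex hull e"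
  proof (elim disjE bexE)
    assume "cell T \<inter> cell T' = {}"
    then show thesis using x by blast
  next
    fix v assume "v \<in> vertices T \<inter> vertices T'" "cell T \<inter> cell T' = {v}"
    moreover from this have "x = v" using x by auto
    ultimately show thesis using that(1) by auto
  next
    fix e assume "e \<in> edges T \<inter> edges T'" "cell T \<inter> cell T' = convex hull e"
    moreover from this have "x \<in> convex hull e" using x by auto
    ultimately show thesis using that(2) by auto
  qed
  then show ?thesis
  proof cases
    case 1
    have "local_interpolant p S g x = g x" if "nondegenerate S" "x \<in> vertices S" for S
      using vertex_is_node[OF p that(2)] shape_fn_combination_node[OF p that(1)]
      by (auto simp: local_interpolant_def)
    then show ?thesis using 1 nd by simp
  next
    case 2
    then show ?thesis using local_interpolants_agree_on_edge[OF p nd] by blast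
  qed
qed simp

lemma cell_subset_closure:
  assumes "conforming_grid \<omega> G" and "T \<in> G"
  shows "cell T \<subseteq> closure \<omega>"
proof -
  have "(\<Union>T \<in> G. cell T) = closure \<omega>"
    using assms(1) by (simp add: conforming_grid_def)
  then show ?thesis using assms(2) by blast
qed

lemma lagrange_nodes_subset:
  assumes "p > 0" and "conforming_grid \<omega> G"
  shows "lagrange_nodes p G \<subseteq> closure \<omega>"
  using cell_subset_closure[OF assms(2)] element_node_in_cell[OF assms(1)]
  unfolding lagrange_nodes_def by blast

text \<open>Since the local interpolants agree on intersections of cells, they can be glued, and the result is
  continuous because the cells form a finite closed cover. This is the conformity of Lagrange
  elements.\<close>

lemma lagrange_interpolation_exists:
  fixes g :: "real^2 \<Rightarrow> real^3"
  assumes p: "p > 0" and G: "conforming_grid \<omega> G"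
  obtains f where "f \<in> lagrange_fe_space p \<omega> G" and "\<And>x. x \<in> lagrange_nodes p G \<Longrightarrow> f x = g x"
proof -
  have cover: "(\<Union>T \<in> G. cell T) = closure \<omega>" and fin: "finite G"
    and nd: "\<And>T. T \<in> G \<Longrightarrow> nondegenerate T"
    using G by (auto simp: conforming_grid_def)
  define f where "f = restrict (\<lambda>x. local_interpolant p (SOME T. T \<in> G \<and> x \<in> cell T) g x) (closure \<omega>)"
  have f: "f x = local_interpolant p T g x" if "T \<in> G" "x \<in> cell T" for T x
  proof -
    \<comment> \<open>The element that the definition selects need not be \<open>T\<close>.\<close>
    let ?S = "SOME T. T \<in> G \<and> x \<in> cell T"
    have S: "?S \<in> G \<and> x \<in> cell ?S"
      by (rule someI[of "\<lambda>T. T \<in> G \<and> x \<in> cell T"]) (use that in simp)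
    have "x \<in> closure \<omega>" using that cover by blast
    then have "f x = local_interpolant p ?S g x"
      by (simp add: f_def)
    also have "\<dots> = local_interpolant p T g x"
      using S that by (intro local_interpolants_agree[OF p G]) auto
    finally show ?thesis .
  qed
  show thesis
  proof (rule that)
    have "continuous_on (cell T) f" if "T \<in> G" for T
      by (rule continuous_on_eq[OF continuous_on_local_interpolant[OF nd[OF that]]])
        (simp add: f[OF that])
    then have "continuous_on (\<Union>T \<in> G. cell T) f"
      by (intro continuous_on_closed_Union fin compact_imp_closed compact_cell)
    moreover have "f \<in> extensional (closure \<omega>)"
      by (simp add: f_def)
    moreover have "\<exists>c. \<forall>x \<in> cell T. f x = (\<Sum>a \<in> ref_indices p T. shape_fn p T a (to_ref T x) *\<^sub>R c a)"
      if "T \<in> G" for T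
      by (rule exI[of _ "\<lambda>a. g (element_node p T a)"])
        (simp add: f[OF that, unfolded local_interpolant_def])
    ultimately show "f \<in> lagrange_fe_space p \<omega> G"
      by (simp add: lagrange_fe_space_def cover)
    fix x assume "x \<in> lagrange_nodes p G"
    then obtain T a where "T \<in> G" "a \<in> ref_indices p T" "x = element_node p T a"
      by (auto simp: lagrange_nodes_def)
    then show "f x = g x"
      using f[OF _ element_node_in_cell[OF p]] shape_fn_combination_node[OF p nd]
      by (simp add: local_interpolant_def)
  qed
qed

lemma lagrange_fe_function_unique:
  assumes p: "p > 0" and G: "conforming_grid \<omega> G"
    and f: "f \<in> lagrange_fe_space p \<omega> G" and f': "f' \<in> lagrange_fe_space p \<omega> G"
    and eq: "\<And>x. x \<in> lagrange_nodes p G \<Longrightarrow> f x = f' x"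
  shows "f = f'"
proof (rule extensionalityI)
  show "f \<in> extensional (closure \<omega>)" "f' \<in> extensional (closure \<omega>)"
    using f f' by (auto simp: lagrange_fe_space_def)
  fix x assume "x \<in> closure \<omega>"
  moreover have "(\<Union>T \<in> G. cell T) = closure \<omega>" "\<forall>T \<in> G. nondegenerate T"
    using G by (simp_all add: conforming_grid_def)
  ultimately obtain T where T: "T \<in> G" "x \<in> cell T" "nondegenerate T"
    by blast
  have local: "g x = local_interpolant p T g x" if g: "g \<in> lagrange_fe_space p \<omega> G" for g
  proof -
    obtain c where c: "\<And>y. y \<in> cell T \<Longrightarrow> g y = (\<Sum>a \<in> ref_indices p T. shape_fn p T a (to_ref T y) *\<^sub>R c a)"
      using g T(1) unfolding lagrange_fe_space_def by blast
    have "g (element_node p T a) = c a" if "a \<in> ref_indices p T" for a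
      using c[OF element_node_in_cell[OF p that]] shape_fn_combination_node[OF p T(3) that] by simp
    then show ?thesis
      using c[OF T(2)] by (simp add: local_interpolant_def)
  qed
  have "local_interpolant p T f x = local_interpolant p T f' x"
    using T(1) eq by (intro local_interpolant_cong) (auto simp: lagrange_nodes_def)
  then show "f x = f' x"
    using local[OF f] local[OF f'] by simp
qed

section \<open>Equivariance of geodesic interpolation\<close>

lemma geodesic_dist_rotated:
  "Q \<in> SO3 \<Longrightarrow> geodesic_dist (Q ** R) (Q ** S) = geodesic_dist R S"
  by (simp add: geodesic_dist_def transpose_mult_rotated)

text \<open>The objective functional of the rotated data at $QY$ equals that of the original data at $Y$, and
  $Y \mapsto QY$ is a bijection of the rotation group; so minimizers are mapped to minimizers, even
  where they are not unique.\<close>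

lemma geodesic_interpolant_rotated:
  assumes Q: "Q \<in> SO3" and S: "geodesic_interpolant p T R \<xi> S"
    and R': "\<And>a. a \<in> ref_indices p T \<Longrightarrow> R' a = Q ** R a"
  shows "geodesic_interpolant p T R' \<xi> (Q ** S)"
proof -
  let ?F = "\<lambda>R S. \<Sum>a \<in> ref_indices p T. shape_fn p T a \<xi> * (geodesic_dist (R a) S)\<^sup>2"
  have F: "?F R' (Q ** Y) = ?F R Y" for Y
    by (intro sum.cong refl) (simp add: R' geodesic_dist_rotated[OF Q])
  have min: "S \<in> SO3" "\<And>Y. Y \<in> SO3 \<Longrightarrow> \<not> ?F R Y < ?F R S"
    using S by (auto simp: geodesic_interpolant_def is_arg_min_def)
  have "\<not> ?F R' Y < ?F R' (Q ** S)" if "Y \<in> SO3" for Y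
  proof -
    have "?F R' Y = ?F R (transpose Q ** Y)"
      using F[of "transpose Q ** Y"] by (simp only: SO3_cancel_left(2)[OF Q])
    then show ?thesis
      using min(2)[OF SO3_mult[OF SO3_transpose[OF Q] that]] F[of S] by linarith
  qed
  then show ?thesis
    using SO3_mult[OF Q min(1)] by (simp add: geodesic_interpolant_def is_arg_min_def)
qed

lemma geodesic_fe_space_rotated:
  assumes p: "p > 0" and G: "conforming_grid \<omega> G" and Q: "Q \<in> SO3"
    and R: "R \<in> geodesic_fe_space p \<omega> G"
  shows "(\<lambda>x\<in>closure \<omega>. Q ** R x) \<in> geodesic_fe_space p \<omega> G"
proof -
  let ?R' = "\<lambda>x\<in>closure \<omega>. Q ** R x"
  have R: "\<And>x. x \<in> closure \<omega> \<Longrightarrow> R x \<in> SO3" "continuous_on (closure \<omega>) R"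
    "\<And>T x. T \<in> G \<Longrightarrow> x \<in> cell T \<Longrightarrow>
      geodesic_interpolant p T (\<lambda>a. R (element_node p T a)) (to_ref T x) (R x)"
    using R by (auto simp: geodesic_fe_space_def PiE_iff)
  note cell = cell_subset_closure[OF G, THEN subsetD]
  have "continuous_on (closure \<omega>) (\<lambda>x. Q ** R x)"
    by (rule bounded_linear.continuous_on[OF bounded_linear_matrix_mult R(2)])
  then have "continuous_on (closure \<omega>) ?R'"
    by (rule continuous_on_eq) simp
  moreover have "?R' \<in> closure \<omega> \<rightarrow>\<^sub>E SO3"
    using R(1) SO3_mult[OF Q] by auto
  moreover have "geodesic_interpolant p T (\<lambda>a. ?R' (element_node p T a)) (to_ref T x) (?R' x)"
    if T: "T \<in> G" "x \<in> cell T" for T x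
  proof -
    have "geodesic_interpolant p T (\<lambda>a. ?R' (element_node p T a)) (to_ref T x) (Q ** R x)"
      by (rule geodesic_interpolant_rotated[OF Q R(3)[OF T]])
        (simp add: cell[OF T(1) element_node_in_cell[OF p]])
    then show ?thesis using cell[OF T] by simp
  qed
  ultimately show ?thesis
    by (simp add: geodesic_fe_space_def)
qed

lemma node_values_rotated:
  assumes "nd ` {1..N} \<subseteq> A"
  shows "node_values N nd (\<lambda>x\<in>A. f (R x)) = (\<lambda>i\<in>{1..N}. f (node_values N nd R i))"
proof -
  have "nd i \<in> A" if "i \<in> {1..N}" for i
    using assms that by blast
  then show ?thesis
    by (auto simp: node_values_def fun_eq_iff)
qed

lemma the_inv_into_eq:
  assumes "\<exists>!x. x \<in> A \<and> f x = y" and "x \<in> A" and "f x = y"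
  shows "the_inv_into A f y = x"
  unfolding the_inv_into_def using assms by (intro the1_equality) auto

text \<open>A geodesic finite element function with coefficients $Qc$ is rotated back by $Q^T$ to one with
  coefficients $c$, so existence and uniqueness are inherited by $Qc$.\<close>

lemma gfe_coeffs_rotated:
  assumes p: "p > 0" and G: "conforming_grid \<omega> G" and nd: "nd ` {1..N} \<subseteq> closure \<omega>"
    and Q: "Q \<in> SO3" and c: "c \<in> gfe_coeffs p \<omega> G N nd"
  shows "(\<lambda>i\<in>{1..N}. Q ** c i) \<in> gfe_coeffs p \<omega> G N nd"
    and "the_inv_into (geodesic_fe_space p \<omega> G) (node_values N nd) (\<lambda>i\<in>{1..N}. Q ** c i) =
      (\<lambda>x\<in>closure \<omega>. Q ** the_inv_into (geodesic_fe_space p \<omega> G) (node_values N nd) c x)"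
proof -
  let ?V = "geodesic_fe_space p \<omega> G" and ?E = "node_values N nd"
  let ?Qc = "\<lambda>i\<in>{1..N}. Q ** c i"
  have c_mem: "c \<in> {1..N} \<rightarrow>\<^sub>E SO3" and ex1: "\<exists>!R. R \<in> ?V \<and> ?E R = c"
    using c by (auto simp: gfe_coeffs_def)
  then obtain R where R: "R \<in> ?V" "?E R = c" by blast
  let ?QR = "\<lambda>x\<in>closure \<omega>. Q ** R x"
  have QR: "?QR \<in> ?V" "?E ?QR = ?Qc"
    using geodesic_fe_space_rotated[OF p G Q R(1)] node_values_rotated[OF nd, of "\<lambda>A. Q ** A" R] R(2)
    by simp_all
  have uniq: "S = ?QR" if S: "S \<in> ?V" "?E S = ?Qc" for S
  proof -
    let ?S' = "\<lambda>x\<in>closure \<omega>. transpose Q ** S x"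
    have "?S' \<in> ?V"
      by (rule geodesic_fe_space_rotated[OF p G SO3_transpose[OF Q] S(1)])
    moreover have "?E ?S' = c"
    proof -
      have "?E ?S' = (\<lambda>i\<in>{1..N}. transpose Q ** ?Qc i)"
        using node_values_rotated[OF nd, of "\<lambda>A. transpose Q ** A" S] unfolding S(2) .
      also have "\<dots> = restrict c {1..N}"
        by (rule restrict_ext) (simp add: SO3_cancel_left(1)[OF Q])
      also have "\<dots> = c"
        using c_mem by (simp add: extensional_restrict PiE_def)
      finally show ?thesis .
    qed
    ultimately have "?S' = R" using ex1 R by blast
    then have S_eq: "S x = Q ** R x" if "x \<in> closure \<omega>" for x
      using that SO3_cancel_left(2)[OF Q, of "S x"] by auto
    have "S \<in> extensional (closure \<omega>)"
      using S(1) by (simp add: geodesic_fe_space_def PiE_def)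
    then show ?thesis
      by (rule extensionalityI[OF _ restrict_extensional]) (simp add: S_eq)
  qed
  have ex1Q: "\<exists>!S. S \<in> ?V \<and> ?E S = ?Qc"
    using QR uniq by blast
  then show "?Qc \<in> gfe_coeffs p \<omega> G N nd"
    using c_mem SO3_mult[OF Q] by (auto simp: gfe_coeffs_def)
  have "the_inv_into ?V ?E c = R"
    by (rule the_inv_into_eq) (fact ex1 R)+
  moreover have "the_inv_into ?V ?E ?Qc = ?QR"
    by (rule the_inv_into_eq) (fact ex1Q QR)+
  ultimately show "the_inv_into ?V ?E ?Qc = (\<lambda>x\<in>closure \<omega>. Q ** the_inv_into ?V ?E c x)"
    by simp
qed

section \<open>Equivariance of Lagrange interpolation\<close>

lemma lagrange_fe_space_rotated:
  assumes G: "conforming_grid \<omega> G" and f: "f \<in> lagrange_fe_space p \<omega> G"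
  shows "(\<lambda>x\<in>closure \<omega>. Q *v f x) \<in> lagrange_fe_space p \<omega> G"
proof -
  note cell = cell_subset_closure[OF G, THEN subsetD]
  interpret Q: bounded_linear "(*v) Q" by (rule matrix_vector_mul_bounded_linear)
  have "continuous_on (closure \<omega>) (\<lambda>x. Q *v f x)"
    using f by (intro Q.continuous_on) (simp add: lagrange_fe_space_def)
  then have "continuous_on (closure \<omega>) (\<lambda>x\<in>closure \<omega>. Q *v f x)"
    by (rule continuous_on_eq) simp
  moreover have "\<exists>c. \<forall>x \<in> cell T. (\<lambda>x\<in>closure \<omega>. Q *v f x) x =
      (\<Sum>a \<in> ref_indices p T. shape_fn p T a (to_ref T x) *\<^sub>R c a)" if T: "T \<in> G" for T
  proof -
    obtain c where c: "\<And>x. x \<in> cell T \<Longrightarrow> f x = (\<Sum>a \<in> ref_indices p T. shape_fn p T a (to_ref T x) *\<^sub>R c a)"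
      using f T unfolding lagrange_fe_space_def by blast
    show ?thesis
      by (rule exI[of _ "\<lambda>a. Q *v c a"]) (simp add: cell[OF T] c Q.sum Q.scaleR)
  qed
  ultimately show ?thesis
    by (simp add: lagrange_fe_space_def)
qed

lemma lagrange_fe_function_ex1:
  assumes p: "p > 0" and G: "conforming_grid \<omega> G"
    and nd: "bij_betw nd {1..N} (lagrange_nodes p G)" and v: "v \<in> {1..N} \<rightarrow>\<^sub>E UNIV"
  shows "\<exists>!f. f \<in> lagrange_fe_space p \<omega> G \<and> node_values N nd f = v"
proof -
  have inj: "inj_on nd {1..N}" and img: "nd ` {1..N} = lagrange_nodes p G"
    using nd by (auto simp: bij_betw_def)
  obtain f where f: "f \<in> lagrange_fe_space p \<omega> G"
    "\<And>x. x \<in> lagrange_nodes p G \<Longrightarrow> f x = v (the_inv_into {1..N} nd x)"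
    using lagrange_interpolation_exists[OF p G, of "\<lambda>x. v (the_inv_into {1..N} nd x)"] by blast
  have f_nd: "f (nd i) = v i" if "i \<in> {1..N}" for i
  proof -
    have "nd i \<in> lagrange_nodes p G"
      unfolding img[symmetric] using that by (rule imageI)
    then show ?thesis
      using f(2) the_inv_into_f_f[OF inj that] by simp
  qed
  have nv: "node_values N nd f = v"
  proof -
    have "node_values N nd f = restrict v {1..N}"
      unfolding node_values_def by (rule restrict_ext) (rule f_nd)
    also have "\<dots> = v"
      using v by (simp add: extensional_restrict PiE_def)
    finally show ?thesis .
  qed
  show ?thesis
  proof (rule ex1I[of _ f])
    fix f' assume f': "f' \<in> lagrange_fe_space p \<omega> G \<and> node_values N nd f' = v"
    show "f' = f"
    proof (rule lagrange_fe_function_unique[OF p G])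
      fix x assume "x \<in> lagrange_nodes p G"
      then obtain i where i: "i \<in> {1..N}" "x = nd i" using img by blast
      have "node_values N nd f' i = node_values N nd f i" using f' nv by simp
      then show "f' x = f x" using i by (simp add: node_values_def)
    qed (use f f' in auto)
  qed (use f nv in auto)
qed

text \<open>The function belonging to a coefficient vector is a definite description, which means something
  only if exactly one such function exists. Hence equivariance needs both parts of
  \<open>lagrange_fe_function_ex1\<close>, in particular the conformity of the grid.\<close>

lemma lagrange_coeffs_rotated:
  assumes p: "p > 0" and G: "conforming_grid \<omega> G"
    and nd: "bij_betw nd {1..N} (lagrange_nodes p G)" and v: "v \<in> {1..N} \<rightarrow>\<^sub>E UNIV"
  shows "the_inv_into (lagrange_fe_space p \<omega> G) (node_values N nd) (\<lambda>i\<in>{1..N}. Q *v v i) =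
      (\<lambda>x\<in>closure \<omega>. Q *v the_inv_into (lagrange_fe_space p \<omega> G) (node_values N nd) v x)"
proof -
  let ?V = "lagrange_fe_space p \<omega> G" and ?E = "node_values N nd"
  note ex1 = lagrange_fe_function_ex1[OF p G nd]
  obtain f where f: "f \<in> ?V" "?E f = v"
    using ex1[OF v] by blast
  have sub: "nd ` {1..N} \<subseteq> closure \<omega>"
    using nd lagrange_nodes_subset[OF p G] by (simp add: bij_betw_def)
  have Qv: "(\<lambda>i\<in>{1..N}. Q *v v i) \<in> {1..N} \<rightarrow>\<^sub>E UNIV" by auto
  have "?E (\<lambda>x\<in>closure \<omega>. Q *v f x) = (\<lambda>i\<in>{1..N}. Q *v v i)"
    using node_values_rotated[OF sub, of "\<lambda>x. Q *v x" f] f(2) by simp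
  then have "the_inv_into ?V ?E (\<lambda>i\<in>{1..N}. Q *v v i) = (\<lambda>x\<in>closure \<omega>. Q *v f x)"
    by (intro the_inv_into_eq ex1[OF Qv] lagrange_fe_space_rotated[OF G f(1)])
  moreover have "the_inv_into ?V ?E v = f"
    by (rule the_inv_into_eq) (fact ex1[OF v] f)+
  ultimately show ?thesis by simp
qed

section \<open>Invariance of the algebraic energy\<close>

theorem theorem10:
  fixes \<omega> :: "(real^2) set" and G :: "element set"
    and h \<mu> \<mu>c lam \<kappa> Lc q :: real
    and p1 p2 N1 N2 :: nat and nd1 nd2 :: "nat \<Rightarrow> real^2"
  assumes "bounded_lipschitz_domain \<omega>" and "piecewise_linear_boundary \<omega>"
    and "h > 0" and "\<mu> > 0" and "lam > 0" and "\<mu>c \<ge> 0" and "0 < \<kappa>" and "\<kappa> \<le> 1"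
    and "Lc > 0" and "q \<ge> 2"
    and "conforming_grid \<omega> G" and "p1 \<ge> 1" and "p2 \<ge> 1"
    and "bij_betw nd1 {1..N1} (lagrange_nodes p1 G)"
    and "bij_betw nd2 {1..N2} (lagrange_nodes p2 G)"
  shows "\<forall>Q \<in> SO3. \<forall>m \<in> {1..N1} \<rightarrow>\<^sub>E (UNIV :: (real^3) set). \<forall>R \<in> gfe_coeffs p2 \<omega> G N2 nd2.
           (\<lambda>i\<in>{1..N2}. Q ** R i) \<in> gfe_coeffs p2 \<omega> G N2 nd2 \<and>
           algebraic_energy h \<mu> \<mu>c lam \<kappa> Lc q \<omega> G p1 N1 nd1 p2 N2 nd2
             (\<lambda>i\<in>{1..N1}. Q *v m i) (\<lambda>i\<in>{1..N2}. Q ** R i) =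
           algebraic_energy h \<mu> \<mu>c lam \<kappa> Lc q \<omega> G p1 N1 nd1 p2 N2 nd2 m R"
proof (intro ballI conjI)
  fix Q :: "real^3^3" and m :: "nat \<Rightarrow> real^3" and R :: "nat \<Rightarrow> real^3^3"
  assume Q: "Q \<in> SO3" and m: "m \<in> {1..N1} \<rightarrow>\<^sub>E UNIV" and R: "R \<in> gfe_coeffs p2 \<omega> G N2 nd2"
  have p: "p1 > 0" "p2 > 0" using \<open>p1 \<ge> 1\<close> \<open>p2 \<ge> 1\<close> by auto
  note G = \<open>conforming_grid \<omega> G\<close>
  have \<omega>: "open \<omega>"
    using \<open>bounded_lipschitz_domain \<omega>\<close> by (simp add: bounded_lipschitz_domain_def)
  have nd2: "nd2 ` {1..N2} \<subseteq> closure \<omega>"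
    using \<open>bij_betw nd2 _ _\<close> lagrange_nodes_subset[OF p(2) G] by (simp add: bij_betw_def)
  note rotated = gfe_coeffs_rotated[OF p(2) G nd2 Q R]
  show "(\<lambda>i\<in>{1..N2}. Q ** R i) \<in> gfe_coeffs p2 \<omega> G N2 nd2"
    by (rule rotated(1))
  show "algebraic_energy h \<mu> \<mu>c lam \<kappa> Lc q \<omega> G p1 N1 nd1 p2 N2 nd2
      (\<lambda>i\<in>{1..N1}. Q *v m i) (\<lambda>i\<in>{1..N2}. Q ** R i) =
    algebraic_energy h \<mu> \<mu>c lam \<kappa> Lc q \<omega> G p1 N1 nd1 p2 N2 nd2 m R"
    unfolding algebraic_energy_def rotated(2)
      lagrange_coeffs_rotated[OF p(1) G \<open>bij_betw nd1 _ _\<close> m]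
    by (rule shell_energy_rotated[OF \<omega> Q]) (use closure_subset[of \<omega>] in auto)
qed

end
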